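(* Let $n,d\ge 1$ be integers and $\phi>0$. Let $\mathcal{S}\subseteq\{0,1\}^n$ be an arbitrary fixed set of solutions (viewed as column vectors). For each $x\in\mathcal{S}$ let $c_{d+1}(x)\in\mathbb{R}$ be a fixed real number, chosen in advance, such that these numbers are distinct for distinct $x\in\mathcal{S}$. Let $\mathbf{W}$ be a random $d\times n$ matrix whose entries are independent continuous random variables, each supported on $[-1,1]$ and each having probability density function bounded above by $\phi$. For $x\in\mathcal{S}$ define its objective vector $c(x)\in\mathbb{R}^{d+1}$ by $(c_1(x),\dots,c_d(x))^{T}=\mathbf{W}x$ and with last coordinate $c_{d+1}(x)$. Let $\mathrm{PO}$ be the set of $x\in\mathcal{S}$ that are Pareto optimal, i.e. such that for every $z\in\mathcal{S}\setminus\{x\}$ there is $i\in\{1,\dots,d+1\}$ with $c_i(x)>c_i(z)$. Then \[ \mathbb{E}_{\mathbf{W}}\bigl[|\mathrm{PO}|\bigr]\le 2\cdot(4\phi d)^{d(d+1)/2}\cdot n^{2d}. \]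
   Context: Higher objective values are preferable: a vector $p\in\mathbb{R}^{d+1}$ dominates $q\in\mathbb{R}^{d+1}$ if $p_i\ge q_i$ for all $i$, and $x$ is Pareto optimal if its objective vector is not dominated by the objective vector of any other solution in $\mathcal{S}$ (equivalently, as stated in the claim). The first $d$ objectives are linear with random coefficients given by the rows of $\mathbf{W}$; the $(d+1)$-th objective is arbitrary and deterministic. *)

theory Defs
  imports "HOL-Probability.Probability"
begin

text \<open>Vectors in \<open>\<real>\<^sup>n\<close> are functions on \<open>{1..n}\<close>. Solutions are taken extensional
  (\<open>undefined\<close> outside \<open>{1..n}\<close>), so that distinct functions are distinct vectors.\<close>

definition binary_vectors :: "nat \<Rightarrow> (nat \<Rightarrow> real) set" where
  "binary_vectors n = {1..n} \<rightarrow>\<^sub>E {0, 1}"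

definition objective ::
  "nat \<Rightarrow> nat \<Rightarrow> (nat \<Rightarrow> nat \<Rightarrow> real) \<Rightarrow> ((nat \<Rightarrow> real) \<Rightarrow> real) \<Rightarrow> (nat \<Rightarrow> real) \<Rightarrow> nat \<Rightarrow> real" where
  "objective n d A g x i = (if i = d + 1 then g x else (\<Sum>j\<in>{1..n}. A i j * x j))"

definition pareto_optima :: "nat \<Rightarrow> ('x \<Rightarrow> nat \<Rightarrow> real) \<Rightarrow> 'x set \<Rightarrow> 'x set" where
  "pareto_optima m c S = {x \<in> S. \<forall>z \<in> S - {x}. \<exists>i \<in> {1..m}. c x i > c z i}"

definition has_density_bounded_by :: "'a measure \<Rightarrow> ('a \<Rightarrow> real) \<Rightarrow> real \<Rightarrow> bool" where
  "has_density_bounded_by M X \<phi> \<longleftrightarrow>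
     (\<exists>f. distributed M lborel X f \<and> (\<forall>t. f t \<le> ennreal \<phi>))"

end

theory Submission
  imports Defs
begin

text \<open>
  The argument follows Moitra and O'Donnell. Fix a Pareto optimum \<open>x\<close> and put \<open>T\<^sub>0 = S\<close>. For
  \<open>t = 0, \<dots>, d - 1\<close>, let \<open>z\<^sub>t\<close> maximise objective \<open>d + 1 - t\<close> among the elements of \<open>T\<^sub>t\<close> that beat \<open>x\<close> in
  the objectives \<open>1, \<dots>, d - t\<close>, choose a column \<open>j\<^sub>t\<close> in which \<open>z\<^sub>t\<close> and \<open>x\<close> differ, and let \<open>T\<^bsub>t+1\<^esub>\<close>
  consist of the elements of \<open>T\<^sub>t\<close> that agree with \<open>x\<close> in column \<open>j\<^sub>t\<close> and beat \<open>z\<^sub>t\<close> in objective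
  \<open>d + 1 - t\<close>. Then \<open>x\<close> is the maximiser of objective 1 in \<open>T\<^sub>d\<close>.

  Given the columns \<open>j\<^sub>t\<close> and the bits of \<open>x\<close> and the \<open>z\<^sub>t\<close> in these columns (a testimony), this
  procedure can be run backwards to recover \<open>x\<close> without knowing the entries \<open>(i, j\<^sub>l)\<close> with
  \<open>l + i \<le> d\<close>, provided one is told for each row \<open>i\<close> the \<open>d + 1 - i\<close> thresholds that replace the
  comparisons with \<open>x\<close>. If the \<open>i\<close>-th visible value of \<open>x\<close> is only known to lie in \<open>(q\<^sub>i - \<epsilon>, q\<^sub>i]\<close>,
  then the map from hidden entries to thresholds is, for fixed \<open>q\<close>, triangular with diagonal entries
  \<open>\<plusminus>1\<close>. Integrating over \<open>q\<close> as well, one may thus replace the hidden entries by the thresholds, at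
  the cost of one factor \<open>\<phi>\<close> per hidden entry; then \<open>x\<close> no longer depends on \<open>q\<close>, so the \<open>q\<close>-integral
  contributes \<open>\<epsilon>\<^sup>d\<close>, which cancels the normalisation. The thresholds of a row are confined to an
  interval of length \<open>O(n)\<close> for the first and, relative to the first, of length \<open>2d\<close> for the others. Summing over the
  testimonies and letting \<open>\<epsilon> \<rightarrow> 0\<close> gives the bound.
\<close>

section \<open>Testimonies of Pareto optima\<close>

lemma finite_binary_vectors: "finite (binary_vectors n)"
  unfolding binary_vectors_def by (intro finite_PiE) auto

lemma binary_vectors_cases:
  assumes "x \<in> binary_vectors n" "m \<in> {1..n}"
  shows "x m = 0 \<or> x m = 1"
  using PiE_mem[of x "{1..n}" "\<lambda>_. {0,1}" m] assms unfolding binary_vectors_def by auto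

lemma binary_vectors_diff:
  assumes "x \<in> binary_vectors n" "z \<in> binary_vectors n" "x \<noteq> z"
  obtains m where "m \<in> {1..n}" "z m = 1 - x m"
proof -
  have "\<exists>m\<in>{1..n}. x m \<noteq> z m"
    using assms unfolding binary_vectors_def by (metis PiE_ext)
  then obtain m where m: "m \<in> {1..n}" "x m \<noteq> z m" by blast
  then have "z m = 1 - x m"
    using binary_vectors_cases[OF assms(1) m(1)] binary_vectors_cases[OF assms(2) m(1)] by auto
  with m that show ?thesis by blast
qed

text \<open>One round of the procedure, \<open>U\<close> being the columns used so far. The column
  found is new because \<open>T\<close>, and with it the maximiser \<open>z\<close>, agrees with
  \<open>x\<close> on \<open>U\<close>. Members of \<open>A\<close> beat \<open>x\<close> in
  objectives 1 to \<open>d - t\<close>, so by \<open>nodom\<close> they lose in objective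
  \<open>d + 1 - t\<close>, strictly by \<open>inj\<close>.\<close>

lemma pareto_step:
  fixes c :: "nat \<Rightarrow> (nat \<Rightarrow> real) \<Rightarrow> real"
  assumes T: "T \<subseteq> binary_vectors n" and x: "x \<in> T"
    and inj: "inj_on (c (d + 1 - t)) T"
    and nodom: "\<And>y. y \<in> T \<Longrightarrow> \<exists>i\<in>{1..d + 1 - t}. c i y \<le> c i x"
    and t: "t < d" "d \<le> n" and U: "finite U" "card U \<le> t"
    and TU: "\<forall>y\<in>T. \<forall>m\<in>U. y m = x m"
    and A: "A = {a \<in> T. \<forall>i\<in>{1..d - t}. c i x < c i a}"
  shows "\<exists>m z. m \<in> {1..n} - U \<and> z \<in> binary_vectors n \<and> (\<forall>k\<in>U. z k = x k) \<and> z m = 1 - x m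
           \<and> (A = {} \<or> z \<in> A \<and> (\<forall>a\<in>A. c (d + 1 - t) a \<le> c (d + 1 - t) z))"
    and "\<forall>a\<in>A. c (d + 1 - t) a < c (d + 1 - t) x"
proof -
  have finT: "finite T" using T finite_binary_vectors finite_subset by blast
  have xA: "x \<notin> A" using t by (auto simp: A)
  show "\<exists>m z. m \<in> {1..n} - U \<and> z \<in> binary_vectors n \<and> (\<forall>k\<in>U. z k = x k) \<and> z m = 1 - x m
           \<and> (A = {} \<or> z \<in> A \<and> (\<forall>a\<in>A. c (d + 1 - t) a \<le> c (d + 1 - t) z))"
  proof (cases "A = {}")
    case True
    have "card U < card {1..n}" using U t by simp
    then have "\<not> {1..n} \<subseteq> U" using card_mono[OF U(1)] leD by blast
    then obtain m where m: "m \<in> {1..n} - U" by blast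
    have "x \<in> binary_vectors n" using T x by blast
    then have "x(m := 1 - x m) \<in> binary_vectors n"
      using m binary_vectors_cases[of x n m] unfolding binary_vectors_def
      by (auto simp: PiE_iff extensional_def)
    with m True show ?thesis by (intro exI[of _ m] exI[of _ "x(m := 1 - x m)"]) auto
  next
    case False
    have "finite A" using finT by (simp add: A)
    then have "Max (c (d + 1 - t) ` A) \<in> c (d + 1 - t) ` A" using False by simp
    then obtain z where z: "z \<in> A" "c (d + 1 - t) z = Max (c (d + 1 - t) ` A)" by auto
    then have z: "z \<in> A" "\<forall>a\<in>A. c (d + 1 - t) a \<le> c (d + 1 - t) z"
      using \<open>finite A\<close> by auto
    have zT: "z \<in> T" using z by (simp add: A)
    have "x \<noteq> z" using z xA by blast
    with zT x T obtain m where m: "m \<in> {1..n}" "z m = 1 - x m"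
      using binary_vectors_diff by (metis subsetD)
    have "x m = 0 \<or> x m = 1" using binary_vectors_cases m(1) x T by blast
    then have "m \<notin> U" using TU zT m(2) by auto
    with m z zT TU T show ?thesis by (intro exI[of _ m] exI[of _ z]) auto
  qed
  show "\<forall>a\<in>A. c (d + 1 - t) a < c (d + 1 - t) x"
  proof
    fix a assume a: "a \<in> A"
    then have aT: "a \<in> T" by (simp add: A)
    from nodom[OF this] obtain i where i: "i \<in> {1..d+1-t}" "c i a \<le> c i x" by blast
    have "i = d + 1 - t"
    proof (rule ccontr)
      assume "i \<noteq> d + 1 - t"
      then have "i \<in> {1..d-t}" using i by auto
      then have "c i x < c i a" using a by (simp add: A)
      with i show False by simp
    qed
    moreover have "c (d+1-t) a \<noteq> c (d+1-t) x"
      using inj aT x a xA by (auto dest: inj_onD)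
    ultimately show "c (d + 1 - t) a < c (d + 1 - t) x" using i by auto
  qed
qed

text \<open>Iterates \<open>pareto_step\<close> by dependent choice on states (candidates, used
  columns, next column, maximiser). The invariant is that no candidate beats \<open>x\<close> in all
  of the objectives 1 to \<open>d + 1 - t\<close>; after \<open>d\<close> rounds only objective 1 is
  left.\<close>

lemma testimony_exists:
  fixes c :: "nat \<Rightarrow> (nat \<Rightarrow> real) \<Rightarrow> real"
  assumes S: "S \<subseteq> binary_vectors n" and dn: "1 \<le> d" "d \<le> n"
    and inj: "\<And>i. i \<in> {1..d + 1} \<Longrightarrow> inj_on (c i) S"
    and x: "x \<in> pareto_optima (d + 1) (\<lambda>y i. c i y) S"
  defines "A \<equiv> \<lambda>T t. {a \<in> T t. \<forall>i\<in>{1..d - t}. c i x < c i a}"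
  obtains T and j :: "nat \<Rightarrow> nat" and z where "T 0 = S"
    and "inj_on j {..<d}" and "j ` {..<d} \<subseteq> {1..n}"
    and "\<And>t. t < d \<Longrightarrow> T (Suc t) = {y \<in> T t. y (j t) = x (j t) \<and>
            (\<forall>a\<in>A T t. c (d + 1 - t) a < c (d + 1 - t) y)}"
    and "\<And>t. t < d \<Longrightarrow> z t \<in> binary_vectors n"
    and "\<And>t l. t < d \<Longrightarrow> l < t \<Longrightarrow> z t (j l) = x (j l)"
    and "\<And>t. t < d \<Longrightarrow> z t (j t) = 1 - x (j t)"
    and "\<And>t. t < d \<Longrightarrow> A T t = {} \<or>
            z t \<in> A T t \<and> (\<forall>a\<in>A T t. c (d + 1 - t) a \<le> c (d + 1 - t) (z t))"
    and "x \<in> T d" and "\<And>y. y \<in> T d \<Longrightarrow> y \<noteq> x \<Longrightarrow> c 1 y < c 1 x"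
proof -
  define B where "B = (\<lambda>T t. {a \<in> T. \<forall>i\<in>{1..d - t}. c i x < c i a})"
  define inv where "inv = (\<lambda>t T U. T \<subseteq> S \<and> x \<in> T \<and> finite U \<and> card U \<le> t \<and>
     (\<forall>y\<in>T. \<forall>m\<in>U. y m = x m) \<and> (\<forall>y\<in>T. \<exists>i\<in>{1..d + 1 - t}. c i y \<le> c i x))"
  \<comment> \<open>The guards make the condition void beyond \<open>d\<close>, since dependent
    choice wants a state for every natural number; state \<open>d\<close> itself needs no further
    column or vector.\<close>
  define P where "P = (\<lambda>t (T, U, m, z). t \<le> d \<longrightarrow> inv t T U \<and> (t = 0 \<longrightarrow> T = S) \<and>
     (t < d \<longrightarrow> m \<in> {1..n} - U \<and> z \<in> binary_vectors n \<and> (\<forall>k\<in>U. z k = x k) \<and> z m = 1 - x m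
           \<and> (B T t = {} \<or> z \<in> B T t \<and> (\<forall>a\<in>B T t. c (d + 1 - t) a \<le> c (d + 1 - t) z))))"
  define Q where "Q = (\<lambda>t (T, U, m, z :: nat \<Rightarrow> real) (T', U', m' :: nat, z' :: nat \<Rightarrow> real).
     t < d \<longrightarrow> U' = insert m U \<and>
     T' = {y \<in> T. y m = x m \<and> (\<forall>a\<in>B T t. c (d + 1 - t) a < c (d + 1 - t) y)})"
  have choice: "\<exists>m z. m \<in> {1..n} - U \<and> z \<in> binary_vectors n \<and> (\<forall>k\<in>U. z k = x k) \<and> z m = 1 - x m
           \<and> (B T t = {} \<or> z \<in> B T t \<and> (\<forall>a\<in>B T t. c (d + 1 - t) a \<le> c (d + 1 - t) z))"
    and below: "\<forall>a\<in>B T t. c (d + 1 - t) a < c (d + 1 - t) x" if "inv t T U" "t < d" for t T U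
  proof -
    have 1: "T \<subseteq> binary_vectors n" "x \<in> T" "finite U" "card U \<le> t"
      using that S by (auto simp: inv_def)
    have 2: "inj_on (c (d + 1 - t)) T"
      using inj[of "d+1-t"] that by (intro inj_on_subset[of _ S T]) (auto simp: inv_def)
    have 3: "\<And>y. y \<in> T \<Longrightarrow> \<exists>i\<in>{1..d + 1 - t}. c i y \<le> c i x"
       "\<forall>y\<in>T. \<forall>m\<in>U. y m = x m" using that by (auto simp: inv_def)
    note * = pareto_step[where A = "B T t" and c = c and d = d and t = t and T = T and x = x and n = n and U = U, OF 1(1,2) 2 3(1) that(2) dn(2) 1(3,4) 3(2)]
    show "\<exists>m z. m \<in> {1..n} - U \<and> z \<in> binary_vectors n \<and> (\<forall>k\<in>U. z k = x k) \<and> z m = 1 - x m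
           \<and> (B T t = {} \<or> z \<in> B T t \<and> (\<forall>a\<in>B T t. c (d + 1 - t) a \<le> c (d + 1 - t) z))"
      by (rule *(1)) (auto simp: B_def)
    show "\<forall>a\<in>B T t. c (d + 1 - t) a < c (d + 1 - t) x"
      by (rule *(2)) (auto simp: B_def)
  qed
  have xS: "x \<in> S" and opt: "\<And>y. y \<in> S \<Longrightarrow> y \<noteq> x \<Longrightarrow> \<exists>i\<in>{1..d+1}. c i y < c i x"
    using x by (auto simp: pareto_optima_def)
  have inv0: "inv 0 S {}"
  proof -
    have "\<exists>i\<in>{1..d + 1}. c i y \<le> c i x" if "y \<in> S" for y
    proof (cases "y = x")
      case True
      then show ?thesis by (intro bexI[of _ 1]) auto
    next
      case False
      then show ?thesis using opt[OF that] less_imp_le by blast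
    qed
    then show ?thesis using xS by (simp add: inv_def)
  qed
  have "\<exists>f. \<forall>t. P t (f t) \<and> Q t (f t) (f (Suc t))"
  proof (rule dependent_nat_choice)
    have "0 < d" using dn by simp
    from choice[OF inv0 this] obtain m z where "P 0 (S, {}, m, z)"
      unfolding P_def using inv0 by auto
    then show "\<exists>s. P 0 s" ..
  next
    fix s t assume Ps: "P t s"
    obtain T U m z where s: "s = (T, U, m, z)" by (cases s)
    show "\<exists>s'. P (Suc t) s' \<and> Q t s s'"
    proof (cases "t < d")
      case False
      then show ?thesis by (auto simp: P_def Q_def s)
    next
      case True
      define T' where "T' = {y \<in> T. y m = x m \<and> (\<forall>a\<in>B T t. c (d + 1 - t) a < c (d + 1 - t) y)}"
      have I: "inv t T U" and m: "m \<in> {1..n} - U" using Ps True by (auto simp: P_def s)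
      \<comment> \<open>An element beating \<open>x\<close> in all remaining objectives would lie in
        \<open>B T t\<close> and would then have to exceed itself.\<close>
      have "\<exists>i\<in>{1..d + 1 - Suc t}. c i y \<le> c i x" if y: "y \<in> T'" for y
      proof (rule ccontr)
        assume "\<not> ?thesis"
        then have "y \<in> B T t" using y by (auto simp: B_def T'_def not_le)
        then show False using y by (auto simp: T'_def)
      qed
      then have I': "inv (Suc t) T' (insert m U)"
        using I below[OF I True] m unfolding inv_def T'_def
        by (auto simp: card_insert_if)
      show ?thesis
      proof (cases "Suc t < d")
        case True
        from choice[OF I' this] obtain m' z' where "m' \<in> {1..n} - insert m U \<and> z' \<in> binary_vectors n \<and> (\<forall>k\<in>insert m U. z' k = x k) \<and> z' m' = 1 - x m'
           \<and> (B T' (Suc t) = {} \<or> z' \<in> B T' (Suc t) \<and> (\<forall>a\<in>B T' (Suc t). c (d + 1 - Suc t) a \<le> c (d + 1 - Suc t) z'))" by blast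
        then have "P (Suc t) (T', insert m U, m', z')" using I' unfolding P_def by simp
        moreover have "Q t s (T', insert m U, m', z')" by (simp add: Q_def s T'_def)
        ultimately show ?thesis by blast
      next
        case False
        then have "P (Suc t) (T', insert m U, m, z)" using I' unfolding P_def by auto
        moreover have "Q t s (T', insert m U, m, z)" by (simp add: Q_def s T'_def)
        ultimately show ?thesis by blast
      qed
    qed
  qed
  then obtain f where f: "\<And>t. P t (f t)" "\<And>t. Q t (f t) (f (Suc t))" by blast
  define T where "T = (\<lambda>t. fst (f t))"
  define U where "U = (\<lambda>t. fst (snd (f t)))"
  define j where "j = (\<lambda>t. fst (snd (snd (f t))))"
  define z where "z = (\<lambda>t. snd (snd (snd (f t))))"
  have ft: "f t = (T t, U t, j t, z t)" for t by (simp add: T_def U_def j_def z_def)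
  have AB: "A T t = B (T t) t" for t by (simp add: A_def B_def)
  have P: "inv t (T t) (U t)" "t = 0 \<longrightarrow> T t = S" if "t \<le> d" for t
    using f(1)[of t] that by (auto simp: P_def ft)
  have P': "j t \<in> {1..n} - U t" "z t \<in> binary_vectors n" "\<forall>k\<in>U t. z t k = x k" "z t (j t) = 1 - x (j t)"
     "A T t = {} \<or> z t \<in> A T t \<and> (\<forall>a\<in>A T t. c (d + 1 - t) a \<le> c (d + 1 - t) (z t))" if "t < d" for t
    using f(1)[of t] that by (auto simp: P_def ft AB)
  have Q: "U (Suc t) = insert (j t) (U t)"
     "T (Suc t) = {y \<in> T t. y (j t) = x (j t) \<and> (\<forall>a\<in>A T t. c (d + 1 - t) a < c (d + 1 - t) y)}" if "t < d" for t
    using f(2)[of t] that by (auto simp: Q_def ft AB)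
  have U: "t \<le> d \<Longrightarrow> l < t \<Longrightarrow> j l \<in> U t" for t l
    by (induction t) (auto simp: Q(1) less_Suc_eq)
  have "inj_on j {..<d}"
  proof (rule linorder_inj_onI)
    fix a b assume "a < b" "a \<in> {..<d}" "b \<in> {..<d}"
    then show "j a \<noteq> j b" using U[of b a] P'(1)[of b] by auto
  qed auto
  moreover have "c 1 y < c 1 x" if "y \<in> T d" "y \<noteq> x" for y
  proof -
    have "inv d (T d) (U d)" using P by simp
    then have "y \<in> S" "c 1 y \<le> c 1 x" using that by (auto simp: inv_def)
    moreover have "c 1 y \<noteq> c 1 x" using inj[of 1] that \<open>y \<in> S\<close> xS by (auto dest: inj_onD)
    ultimately show ?thesis by simp
  qed
  moreover have "x \<in> T d" using P[of d] by (simp add: inv_def)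
  ultimately show ?thesis
    using P(2)[of 0] P' Q(2) U by (intro that[of T j z]) (auto simp: image_subset_iff)
qed

section \<open>Reconstruction from a testimony\<close>

text \<open>\<open>d \<le> n\<close> leaves room for \<open>d\<close> distinct columns;
  \<open>n < d\<close> is an elementary case of the final theorem. From here on matrices are
  functions on pairs, to fit product measures.\<close>

locale smoothed_pareto =
  fixes n d :: nat and S :: "(nat \<Rightarrow> real) set" and g :: "(nat \<Rightarrow> real) \<Rightarrow> real"
  assumes dn: "1 \<le> d" "d \<le> n" and S: "S \<subseteq> binary_vectors n" and inj_g: "inj_on g S"
begin

abbreviation val :: "(nat \<times> nat \<Rightarrow> real) \<Rightarrow> nat \<Rightarrow> (nat \<Rightarrow> real) \<Rightarrow> real" where
  "val w i y \<equiv> objective n d (curry w) g y i"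

text \<open>Row \<open>i\<close> is compared with \<open>x\<close> in rounds 0 to
  \<open>d - i\<close>, needing one threshold each, and among candidates in round
  \<open>d + 1 - i\<close>, when the relevant ones agree in the columns \<open>j l\<close> with
  \<open>l + i \<le> d\<close>. These entries cancel there and make room for the thresholds.\<close>

definition hidden :: "(nat \<Rightarrow> nat) \<Rightarrow> (nat \<times> nat) set" where
  "hidden j = {(i, j l) | i l. 1 \<le> i \<and> l + i \<le> d}"

definition visible :: "(nat \<Rightarrow> nat) \<Rightarrow> (nat \<times> nat \<Rightarrow> real) \<Rightarrow> nat \<Rightarrow> (nat \<Rightarrow> real) \<Rightarrow> real" where
  "visible j w i y = (if i = d + 1 then g y else \<Sum>m\<in>{1..n} - j ` {l. l + i \<le> d}. w (i, m) * y m)"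

text \<open>The bits in the columns \<open>j l\<close> of the \<open>t\<close>-th vector \<open>z\<^sub>t\<close> (for \<open>t < d\<close>) and of \<open>x\<close> (for \<open>t = d\<close>). Since
  \<open>z\<^sub>t\<close> agrees with \<open>x\<close> in the columns before \<open>j t\<close> and differs from it in \<open>j t\<close>, only \<open>d(d+1)/2\<close>
  bits are needed: \<open>b (l, l)\<close> belongs to \<open>x\<close> and \<open>b (t, l)\<close> with \<open>t < l\<close> to \<open>z\<^sub>t\<close>.\<close>

definition pattern :: "(nat \<times> nat \<Rightarrow> real) \<Rightarrow> nat \<Rightarrow> nat \<Rightarrow> real" where
  "pattern b t l = (if l < t then b (l, l) else if l = t then 1 - b (l, l) else b (t, l))"

definition cls :: "(nat \<Rightarrow> nat) \<Rightarrow> (nat \<times> nat \<Rightarrow> real) \<Rightarrow> nat \<Rightarrow> (nat \<Rightarrow> real) set" where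
  "cls j b t = {y \<in> S. \<forall>l<d. y (j l) = pattern b t l}"

text \<open>Here the hidden entries \<open>w (i, j t)\<close> are not matrix entries but thresholds, as produced by
  \<open>thresholds\<close> below. No maximiser needs to be chosen: an element survives if it beats all the
  competitors with the right bits, among which is \<open>z\<^sub>t\<close>.\<close>

primrec cand :: "(nat \<Rightarrow> nat) \<Rightarrow> (nat \<times> nat \<Rightarrow> real) \<Rightarrow> (nat \<times> nat \<Rightarrow> real) \<Rightarrow> nat \<Rightarrow> (nat \<Rightarrow> real) set" where
  "cand j b w 0 = S"
| "cand j b w (Suc t) = {y \<in> cand j b w t. \<forall>z \<in> cand j b w t \<inter> cls j b t.
      (\<forall>i\<in>{1..d - t}. w (i, j t) < visible j w i z) \<longrightarrow> visible j w (d + 1 - t) z < visible j w (d + 1 - t) y}"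

text \<open>Strictness makes the winner unique, so that for given \<open>w\<close> a testimony
  accounts for at most one vector.\<close>

definition winner :: "(nat \<Rightarrow> nat) \<Rightarrow> (nat \<times> nat \<Rightarrow> real) \<Rightarrow> (nat \<times> nat \<Rightarrow> real) \<Rightarrow> (nat \<Rightarrow> real) \<Rightarrow> bool" where
  "winner j b w x \<longleftrightarrow> x \<in> cand j b w d \<inter> cls j b d \<and>
     (\<forall>y\<in>cand j b w d \<inter> cls j b d. y \<noteq> x \<longrightarrow> visible j w 1 y < visible j w 1 x)"

text \<open>Overwrites the hidden entry \<open>(i, j t)\<close> by the number with which the visible value of a vector with
  bits \<open>pattern b t\<close> has to be compared in order to decide whether its full value exceeds the value of \<open>x\<close>,
  if \<open>q i\<close> stands for the visible value of \<open>x\<close>.\<close>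

definition thresholds :: "(nat \<Rightarrow> nat) \<Rightarrow> (nat \<times> nat \<Rightarrow> real) \<Rightarrow> (nat \<Rightarrow> real) \<Rightarrow> (nat \<times> nat \<Rightarrow> real) \<Rightarrow> nat \<times> nat \<Rightarrow> real" where
  "thresholds j b q w e = (if e \<in> hidden j then
      q (fst e) + (\<Sum>l | l + fst e \<le> d. (pattern b d l - pattern b (the_inv_into {..<d} j (snd e)) l) * w (fst e, j l))
    else w e)"

lemma winner_unique: "winner j b w x \<Longrightarrow> winner j b w y \<Longrightarrow> x = y"
  unfolding winner_def by force

lemma finite_S: "finite S"
  using S finite_binary_vectors finite_subset by blast

lemma visible_cong:
  assumes "\<And>e. e \<notin> hidden j \<Longrightarrow> w e = w' e" "1 \<le> i"
  shows "visible j w i = visible j w' i"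
proof -
  have "(i, m) \<notin> hidden j" if "m \<notin> j ` {l. l + i \<le> d}" for m
    using that by (auto simp: hidden_def)
  then show ?thesis using assms(1) by (auto simp: visible_def fun_eq_iff intro!: sum.cong)
qed

lemma visible_thresholds: "1 \<le> i \<Longrightarrow> visible j (thresholds j b q w) i = visible j w i"
  by (rule visible_cong) (auto simp: thresholds_def)

lemma val_eq_visible:
  assumes j: "inj_on j {..<d}" "j ` {..<d} \<subseteq> {1..n}" and i: "i \<in> {1..d}"
  shows "val w i y = visible j w i y + (\<Sum>l | l + i \<le> d. w (i, j l) * y (j l))"
proof -
  have sub: "{l. l + i \<le> d} \<subseteq> {..<d}" using i by auto
  have inj: "inj_on j {l. l + i \<le> d}" using j sub inj_on_subset by blast
  have "(\<Sum>m\<in>j ` {l. l + i \<le> d}. w (i, m) * y m) = (\<Sum>l | l + i \<le> d. w (i, j l) * y (j l))"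
    by (simp add: sum.reindex[OF inj])
  moreover have "(\<Sum>m\<in>{1..n}. w (i, m) * y m) =
     (\<Sum>m\<in>{1..n} - j ` {l. l + i \<le> d}. w (i, m) * y m) + (\<Sum>m\<in>j ` {l. l + i \<le> d}. w (i, m) * y m)"
    using j sub by (intro sum.subset_diff) auto
  ultimately show ?thesis using i by (simp add: visible_def objective_def)
qed

text \<open>In row \<open>d + 1 - t\<close> the hidden columns are the \<open>j l\<close> with
  \<open>l < t\<close>, where \<open>y\<close> and \<open>z\<close> agree, so their contributions
  cancel. For \<open>t = 0\<close> both sides compare \<open>g\<close>.\<close>

lemma val_less_iff_visible_less:
  assumes j: "inj_on j {..<d}" "j ` {..<d} \<subseteq> {1..n}" and "t \<le> d"
    and eq: "\<And>l. l < t \<Longrightarrow> y (j l) = z (j l)"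
  shows "val w (d + 1 - t) z < val w (d + 1 - t) y \<longleftrightarrow> visible j w (d + 1 - t) z < visible j w (d + 1 - t) y"
proof (cases "t = 0")
  case True
  then show ?thesis by (simp add: objective_def visible_def)
next
  case False
  then have i: "d + 1 - t \<in> {1..d}" using assms by auto
  have "(\<Sum>l | l + (d+1-t) \<le> d. w (d+1-t, j l) * y (j l)) = (\<Sum>l | l + (d+1-t) \<le> d. w (d+1-t, j l) * z (j l))"
    using assms by (intro sum.cong) auto
  then show ?thesis
    unfolding val_eq_visible[OF j i] by simp
qed

lemma thresholds_hidden:
  assumes "inj_on j {..<d}" "1 \<le> i" "t + i \<le> d"
  shows "thresholds j b q w (i, j t) =
    q i + (\<Sum>l | l + i \<le> d. (pattern b d l - pattern b t l) * w (i, j l))"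
proof -
  have "(i, j t) \<in> hidden j" using assms by (auto simp: hidden_def)
  moreover have "the_inv_into {..<d} j (j t) = t"
    using assms by (intro the_inv_into_f_f) auto
  ultimately show ?thesis by (simp add: thresholds_def)
qed

text \<open>Runs the procedure backwards. Distinct solutions differ by at least \<epsilon> in each
  linear objective, so moving the visible value of \<open>x\<close> to \<open>q i\<close> within the
  window changes no comparison. The testimony does not depend on \<open>q\<close>, which is what
  permits integrating over \<open>q\<close>.\<close>

lemma pareto_optimum_is_winner:
  assumes x: "x \<in> pareto_optima (d + 1) (objective n d (curry w) g) S"
    and gap: "\<And>i y z. i \<in> {1..d} \<Longrightarrow> y \<in> S \<Longrightarrow> z \<in> S \<Longrightarrow> y \<noteq> z \<Longrightarrow> \<epsilon> \<le> \<bar>val w i y - val w i z\<bar>"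
    and "0 < \<epsilon>"
  obtains j b where "inj_on j {..<d}" "j \<in> {..<d} \<rightarrow>\<^sub>E {1..n}"
    "b \<in> {(t, l). t \<le> l \<and> l < d} \<rightarrow>\<^sub>E {0, 1}"
    "\<And>q. (\<And>i. i \<in> {1..d} \<Longrightarrow> visible j w i x \<le> q i \<and> q i < visible j w i x + \<epsilon>) \<Longrightarrow> winner j b (thresholds j b q w) x"
proof -
  have inj: "inj_on (val w i) S" if "i \<in> {1..d+1}" for i
  proof (cases "i = d + 1")
    case True
    then show ?thesis using inj_g by (simp add: objective_def inj_on_def)
  next
    case False
    then have "i \<in> {1..d}" using that by auto
    then show ?thesis using gap[of i] \<open>0 < \<epsilon>\<close> by (intro inj_onI) force
  qed
  have xS: "x \<in> S" using x by (simp add: pareto_optima_def)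
  define A where "A = (\<lambda>T t. {a \<in> T t. \<forall>i\<in>{1..d - t}. val w i x < val w i a})"
  have x': "x \<in> pareto_optima (d + 1) (\<lambda>y i. val w i y) S" using x by simp
  obtain T j0 z where T0: "T 0 = S" and j0: "inj_on j0 {..<d}" "j0 ` {..<d} \<subseteq> {1..n}"
    and TSuc: "\<And>t. t < d \<Longrightarrow> T (Suc t) = {y \<in> T t. y (j0 t) = x (j0 t) \<and>
            (\<forall>a\<in>A T t. val w (d + 1 - t) a < val w (d + 1 - t) y)}"
    and z: "\<And>t. t < d \<Longrightarrow> z t \<in> binary_vectors n"
       "\<And>t l. t < d \<Longrightarrow> l < t \<Longrightarrow> z t (j0 l) = x (j0 l)"
       "\<And>t. t < d \<Longrightarrow> z t (j0 t) = 1 - x (j0 t)"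
       "\<And>t. t < d \<Longrightarrow> A T t = {} \<or>
            z t \<in> A T t \<and> (\<forall>a\<in>A T t. val w (d + 1 - t) a \<le> val w (d + 1 - t) (z t))"
    and xT: "x \<in> T d" and xmax: "\<And>y. y \<in> T d \<Longrightarrow> y \<noteq> x \<Longrightarrow> val w 1 y < val w 1 x"
    unfolding A_def
    by (rule testimony_exists[OF S dn inj x']) blast+
  \<comment> \<open>Made extensional so that there are only finitely many testimonies.\<close>
  define j where "j = restrict j0 {..<d}"
  have jj0: "j l = j0 l" if "l < d" for l using that by (simp add: j_def)
  have j: "inj_on j {..<d}" "j ` {..<d} \<subseteq> {1..n}" using j0 by (auto simp: j_def inj_on_def)
  have jE: "j \<in> {..<d} \<rightarrow>\<^sub>E {1..n}" using j0 by (auto simp: j_def)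
  define b where "b = (\<lambda>(t, l)\<in>{(t, l). t \<le> l \<and> l < d}. if t = l then x (j l) else z t (j l))"
  have xbin: "x \<in> binary_vectors n" using S xS by blast
  have bE: "b \<in> {(t, l). t \<le> l \<and> l < d} \<rightarrow>\<^sub>E {0, 1}"
  proof (rule PiE_I)
    fix e :: "nat \<times> nat" assume "e \<in> {(t, l). t \<le> l \<and> l < d}"
    moreover have "x (j l) \<in> {0,1}" "t < d \<Longrightarrow> z t (j l) \<in> {0,1}" if "l < d" for t l
      using that j(2) binary_vectors_cases[OF xbin, of "j l"] binary_vectors_cases[OF z(1)[of t], of "j l"] by auto
    ultimately show "b e \<in> {0, 1}" by (auto simp: b_def split: prod.splits)
  qed (auto simp: b_def)
  have pd: "pattern b d l = x (j l)" if "l < d" for l using that by (simp add: pattern_def b_def)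
  have pt: "pattern b t l = z t (j l)" if "t < d" "l < d" for t l
    using that z(2,3) by (auto simp: pattern_def b_def jj0)
  have TS: "T t \<subseteq> S" if "t \<le> d" for t
    using that by (induction t) (auto simp: T0 TSuc)
  have "winner j b (thresholds j b q w) x"
    if q: "\<And>i. i \<in> {1..d} \<Longrightarrow> visible j w i x \<le> q i \<and> q i < visible j w i x + \<epsilon>" for q
  proof -
    define w' where "w' = thresholds j b q w"
    have pv: "visible j w' i = visible j w i" if "1 \<le> i" for i using visible_thresholds that by (simp add: w'_def)
    \<comment> \<open>After cancelling hidden parts, the left side says
      \<open>val w i x + (q i - visible j w i x) < val w i y\<close>, with a perturbation that is
      nonnegative and below \<epsilon>. The flipped bit in column \<open>j t\<close> shows
      \<open>y \<noteq> x\<close>, so the gap absorbs it.\<close>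
    have thresh: "w' (i, j t) < visible j w' i y \<longleftrightarrow> val w i x < val w i y"
      if y: "y \<in> cls j b t" and t: "t < d" and i: "i \<in> {1..d - t}" for y t i
    proof -
      have i': "i \<in> {1..d}" using i by auto
      have yS: "y \<in> S" using y by (simp add: cls_def)
      have yj: "y (j l) = z t (j l)" if "l < d" for l using y pt[OF t that] that by (simp add: cls_def)
      have "x (j t) = 0 \<or> x (j t) = 1"
        using j(2) t by (intro binary_vectors_cases[OF xbin]) auto
      then have "y \<noteq> x" using yj[OF t] z(3)[OF t] jj0[OF t] by auto
      then have gp: "\<epsilon> \<le> \<bar>val w i y - val w i x\<bar>" using gap[OF i' yS xS] by simp
      have "w' (i, j t) = q i + (\<Sum>l | l + i \<le> d. (pattern b d l - pattern b t l) * w (i, j l))"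
        unfolding w'_def using i t j by (intro thresholds_hidden) auto
      also have "(\<Sum>l | l + i \<le> d. (pattern b d l - pattern b t l) * w (i, j l)) =
          (\<Sum>l | l + i \<le> d. w (i, j l) * x (j l) - w (i, j l) * y (j l))"
        using i by (intro sum.cong) (auto simp: pd pt[OF t] yj algebra_simps)
      also have "\<dots> = (val w i x - visible j w i x) - (val w i y - visible j w i y)"
        unfolding val_eq_visible[OF j i'] by (simp add: sum_subtractf)
      finally show ?thesis
        using q[OF i'] gp pv[of i] i by auto
    qed
    \<comment> \<open>\<open>cand\<close> does not enforce agreement with \<open>x\<close> in the
      chosen columns, so it is matched with \<open>T t\<close> only on vectors that agree. This
      suffices because competitors and winner are filtered by \<open>cls\<close>.\<close>
    have cand_iff: "y \<in> cand j b w' t \<longleftrightarrow> y \<in> T t"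
      if "t \<le> d" "y \<in> S" "\<And>l. l < t \<Longrightarrow> y (j l) = x (j l)" for y t
      using that
    proof (induction t arbitrary: y)
      case 0
      then show ?case by (simp add: T0)
    next
      case (Suc t)
      then have t: "t < d" by simp
      have A_eq: "{a \<in> cand j b w' t \<inter> cls j b t. \<forall>i\<in>{1..d - t}. w' (i, j t) < visible j w' i a}
          = A T t \<inter> cls j b t"
      proof -
        have "a \<in> cand j b w' t \<longleftrightarrow> a \<in> T t" if a: "a \<in> cls j b t" for a
        proof (rule Suc.IH)
          show "a \<in> S" using a by (simp add: cls_def)
          show "a (j l) = x (j l)" if "l < t" for l
          proof -
            have "a (j l) = pattern b t l" using a that t by (simp add: cls_def)
            then show ?thesis using pt[of t l] z(2)[of t l] that t by (simp add: jj0)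
          qed
        qed (use t in simp)
        then show ?thesis using thresh[OF _ t] by (auto simp: A_def)
      qed
      have ord: "visible j w' (d + 1 - t) a < visible j w' (d + 1 - t) y \<longleftrightarrow> val w (d+1-t) a < val w (d+1-t) y"
        if a: "a \<in> cls j b t" for a
      proof -
        have "y (j l) = a (j l)" if "l < t" for l
        proof -
          have "a (j l) = pattern b t l" using a that t by (simp add: cls_def)
          then show ?thesis using pt[of t l] z(2)[of t l] that t Suc.prems(3)[of l] by (simp add: jj0)
        qed
        then have "val w (d + 1 - t) a < val w (d + 1 - t) y \<longleftrightarrow> visible j w (d + 1 - t) a < visible j w (d + 1 - t) y"
          using t by (intro val_less_iff_visible_less[OF j]) auto
        then show ?thesis using pv[of "d+1-t"] t by simp
      qed
      have "y \<in> cand j b w' (Suc t) \<longleftrightarrow> y \<in> cand j b w' t \<and>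
          (\<forall>a\<in>A T t \<inter> cls j b t. visible j w' (d + 1 - t) a < visible j w' (d + 1 - t) y)"
        unfolding A_eq[symmetric] by auto
      also have "\<dots> \<longleftrightarrow> y \<in> T t \<and> (\<forall>a\<in>A T t \<inter> cls j b t. val w (d + 1 - t) a < val w (d + 1 - t) y)"
        using Suc.IH[of y] Suc.prems t ord by auto
      also have "(\<forall>a\<in>A T t \<inter> cls j b t. val w (d + 1 - t) a < val w (d + 1 - t) y) \<longleftrightarrow>
          (\<forall>a\<in>A T t. val w (d + 1 - t) a < val w (d + 1 - t) y)"
      proof (cases "A T t = {}")
        case False
        then have zA: "z t \<in> A T t" "\<forall>a\<in>A T t. val w (d + 1 - t) a \<le> val w (d + 1 - t) (z t)"
          using z(4)[OF t] by auto
        then have "z t \<in> S" using TS[of t] t by (auto simp: A_def)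
        then have "z t \<in> cls j b t" using pt[OF t] by (simp add: cls_def)
        then show ?thesis using zA by (meson IntE IntI le_less_trans)
      qed simp
      also have "y \<in> T t \<and> \<dots> \<longleftrightarrow> y \<in> T (Suc t)"
        using Suc.prems(3)[of t] by (simp add: TSuc[OF t] jj0[OF t])
      finally show ?case .
    qed
    have agree: "y (j l) = x (j l)" if "y \<in> cls j b d" "l < d" for y l
      using that pd by (simp add: cls_def)
    have "x \<in> cand j b w' d \<inter> cls j b d"
      using cand_iff[of d x] xT xS pd by (simp add: cls_def)
    moreover have "visible j w' 1 y < visible j w' 1 x" if y: "y \<in> cand j b w' d \<inter> cls j b d" "y \<noteq> x" for y
    proof -
      have "y \<in> S" using y by (simp add: cls_def)
      then have "y \<in> T d" using y cand_iff[of d y] agree by simp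
      then have "val w 1 y < val w 1 x" using xmax y by simp
      moreover have "x (j l) = y (j l)" if "l < d" for l using agree[of y l] y that by simp
      ultimately show ?thesis
        using val_less_iff_visible_less[OF j, of d x y w] pv[of 1] by simp
    qed
    ultimately show ?thesis unfolding winner_def w'_def by blast
  qed
  then show ?thesis using that[of j b] j jE bE by blast
qed

end

section \<open>Product measures\<close>

text \<open>Peels off one coordinate at a time. The constants vary with \<open>i\<close> because
  later \<open>C\<close> is \<phi> on hidden cells and 1 elsewhere.\<close>

lemma nn_integral_PiM_dominated:
  fixes D N :: "'i \<Rightarrow> 'a measure" and C :: "'i \<Rightarrow> ennreal"
  assumes "finite I" and D: "product_sigma_finite D" and N: "product_sigma_finite N"
    and sets_eq: "\<And>i. i \<in> I \<Longrightarrow> sets (D i) = sets (N i)"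
    and dom: "\<And>i f. i \<in> I \<Longrightarrow> f \<in> borel_measurable (N i) \<Longrightarrow>
        (\<integral>\<^sup>+x. f x \<partial>D i) \<le> C i * (\<integral>\<^sup>+x. f x \<partial>N i)"
    and f: "f \<in> borel_measurable (PiM I N)"
  shows "(\<integral>\<^sup>+w. f w \<partial>PiM I D) \<le> (\<Prod>i\<in>I. C i) * (\<integral>\<^sup>+w. f w \<partial>PiM I N)"
  using assms(1) sets_eq dom f
proof (induction I arbitrary: f rule: finite_induct)
  case empty
  then show ?case
    by (simp add: product_sigma_finite.nn_integral_empty[OF D] product_sigma_finite.nn_integral_empty[OF N])
next
  case (insert i I)
  interpret D: product_sigma_finite D by fact
  interpret N: product_sigma_finite N by fact
  interpret NI: sigma_finite_measure "PiM I N" by (rule N.sigma_finite) fact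
  have f[measurable]: "f \<in> borel_measurable (PiM (insert i I) N)" by fact
  have "sets (PiM (insert i I) D) = sets (PiM (insert i I) N)"
    using insert by (intro sets_PiM_cong) auto
  then have fD: "f \<in> borel_measurable (PiM (insert i I) D)"
    using f by (simp cong: measurable_cong_sets)
  have upd[measurable]: "(\<lambda>y. x(i := y)) \<in> N i \<rightarrow>\<^sub>M PiM (insert i I) N" if "x \<in> space (PiM I N)" for x
    using that by (intro measurable_fun_upd[where J=I]) auto
  have space_eq: "space (PiM I D) = space (PiM I N)"
    using insert.prems(1) by (intro sets_eq_imp_space_eq sets_PiM_cong) auto
  have m[measurable]: "(\<lambda>x. \<integral>\<^sup>+y. f (x(i := y)) \<partial>N i) \<in> borel_measurable (PiM I N)"
  proof -
    have "(\<lambda>(x, y). f (x(i := y))) \<in> borel_measurable (PiM I N \<Otimes>\<^sub>M N i)"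
      unfolding split_beta
      by (rule measurable_compose[OF _ f], rule measurable_fun_upd[where J=I]) auto
    then show ?thesis by (rule sigma_finite_measure.borel_measurable_nn_integral[OF N.sigma_finite_measures, of "\<lambda>x y. f (x(i := y))"])
  qed
  have "(\<integral>\<^sup>+w. f w \<partial>PiM (insert i I) D) = (\<integral>\<^sup>+x. \<integral>\<^sup>+y. f (x(i := y)) \<partial>D i \<partial>PiM I D)"
    using insert fD by (intro D.product_nn_integral_insert) auto
  also have "\<dots> \<le> (\<integral>\<^sup>+x. C i * \<integral>\<^sup>+y. f (x(i := y)) \<partial>N i \<partial>PiM I D)"
    by (intro nn_integral_mono insert.prems(2) measurable_compose[OF upd f])
       (auto simp: space_eq)
  also have "\<dots> \<le> (\<Prod>i\<in>I. C i) * (\<integral>\<^sup>+x. C i * \<integral>\<^sup>+y. f (x(i := y)) \<partial>N i \<partial>PiM I N)"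
    using insert.prems(1,2) by (intro insert.IH borel_measurable_times_ennreal borel_measurable_const m) auto
  also have "\<dots> = (\<Prod>i\<in>insert i I. C i) * (\<integral>\<^sup>+w. f w \<partial>PiM (insert i I) N)"
    using insert.hyps by (simp add: nn_integral_cmult N.product_nn_integral_insert mult_ac)
  finally show ?case .
qed

lemma nn_integral_lborel_reflect_translate:
  fixes f :: "real \<Rightarrow> ennreal" and \<sigma> :: real
  assumes [measurable]: "f \<in> borel_measurable borel" and "\<bar>\<sigma>\<bar> = 1"
  shows "(\<integral>\<^sup>+y. f (\<sigma> * y + a) \<partial>lborel) = (\<integral>\<^sup>+y. f y \<partial>lborel)"
  using nn_integral_real_affine[of f \<sigma> a] assms by (auto simp: add.commute)

text \<open>With the other coordinates frozen, \<open>h\<close> is constant and coordinate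
  \<open>e\<close> undergoes a translation, possibly after a reflection, which preserves Lebesgue
  measure.\<close>

lemma nn_integral_PiM_shear:
  fixes N :: "'i \<Rightarrow> real measure" and f :: "('i \<Rightarrow> real) \<Rightarrow> ennreal"
  assumes "finite I" "product_sigma_finite N" "e \<in> I" "N e = lborel" "\<bar>\<sigma>\<bar> = 1"
    and h: "h \<in> borel_measurable (PiM I N)"
    and indep: "\<And>w y. w \<in> space (PiM I N) \<Longrightarrow> h (w(e := y)) = h w"
    and f: "f \<in> borel_measurable (PiM I N)"
  shows "(\<integral>\<^sup>+w. f (w(e := \<sigma> * w e + h w)) \<partial>PiM I N) = (\<integral>\<^sup>+w. f w \<partial>PiM I N)"
proof -
  interpret N: product_sigma_finite N by fact
  define J where "J = I - {e}"
  have I: "I = insert e J" "finite J" "e \<notin> J" using assms by (auto simp: J_def)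
  note [measurable] = h f
  have e1: "(\<lambda>w. w e) \<in> PiM I N \<rightarrow>\<^sub>M lborel"
    using measurable_component_singleton[OF \<open>e \<in> I\<close>, of N] \<open>N e = lborel\<close> by simp
  then have [measurable]: "(\<lambda>w. w e) \<in> borel_measurable (PiM I N)" by simp
  have "(\<lambda>w. \<sigma> * w e + h w) \<in> PiM I N \<rightarrow>\<^sub>M N e"
    unfolding \<open>N e = lborel\<close> by measurable
  then have "(\<lambda>w. w(e := \<sigma> * w e + h w)) \<in> PiM I N \<rightarrow>\<^sub>M PiM I N"
    using \<open>e \<in> I\<close> by (intro measurable_fun_upd[where J=I]) auto
  then have fm: "(\<lambda>w. f (w(e := \<sigma> * w e + h w))) \<in> borel_measurable (PiM I N)"
    by (rule measurable_compose[OF _ f])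
  have "(\<integral>\<^sup>+w. f (w(e := \<sigma> * w e + h w)) \<partial>PiM I N) =
     (\<integral>\<^sup>+x. \<integral>\<^sup>+y. f (x(e := \<sigma> * y + h (x(e := y)))) \<partial>N e \<partial>PiM J N)"
    using N.product_nn_integral_insert[OF I(2,3), of "\<lambda>w. f (w(e := \<sigma> * w e + h w))"] fm
    by (simp add: I(1)[symmetric])
  also have "\<dots> = (\<integral>\<^sup>+x. \<integral>\<^sup>+y. f (x(e := y)) \<partial>N e \<partial>PiM J N)"
  proof (rule nn_integral_cong)
    fix x assume x: "x \<in> space (PiM J N)"
    have upd: "(\<lambda>y. x(e := y)) \<in> N e \<rightarrow>\<^sub>M PiM I N"
      using x by (intro measurable_fun_upd[where J=J]) (auto simp: I)
    have sp: "x(e := y) \<in> space (PiM I N)" for y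
      using measurable_space[OF upd, of y] \<open>N e = lborel\<close> by simp
    define a where "a = h (x(e := 0))"
    have "h (x(e := y)) = a" for y
      using indep[OF sp, of y 0] by (simp add: a_def)
    then have "(\<integral>\<^sup>+y. f (x(e := \<sigma> * y + h (x(e := y)))) \<partial>N e) = (\<integral>\<^sup>+y. f (x(e := \<sigma> * y + a)) \<partial>lborel)"
      using \<open>N e = lborel\<close> by simp
    also have "\<dots> = (\<integral>\<^sup>+y. f (x(e := y)) \<partial>lborel)"
    proof (rule nn_integral_lborel_reflect_translate)
      show "(\<lambda>y. f (x(e := y))) \<in> borel_measurable borel"
        using measurable_compose[OF upd f] \<open>N e = lborel\<close> by simp
    qed fact
    finally show "(\<integral>\<^sup>+y. f (x(e := \<sigma> * y + h (x(e := y)))) \<partial>N e) = (\<integral>\<^sup>+y. f (x(e := y)) \<partial>N e)"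
      using \<open>N e = lborel\<close> by simp
  qed
  also have "\<dots> = (\<integral>\<^sup>+w. f w \<partial>PiM I N)"
    using N.product_nn_integral_insert[OF I(2,3), of f] f by (simp add: I(1)[symmetric])
  finally show ?thesis .
qed

text \<open>The map is a composition of shears, one per element of \<open>H\<close>. By
  \<open>indep\<close>, \<open>h e\<close> reads coordinates of \<open>H\<close> only if their rank
  exceeds that of \<open>e\<close>; when coordinates are processed by increasing rank, it still sees
  the original values.\<close>

lemma nn_integral_PiM_triangular:
  fixes N :: "'i \<Rightarrow> real measure" and f :: "('i \<Rightarrow> real) \<Rightarrow> ennreal"
    and \<sigma> :: "'i \<Rightarrow> real" and rank :: "'i \<Rightarrow> nat"
  assumes I: "finite I" and N: "product_sigma_finite N" and H: "H \<subseteq> I"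
    and lb: "\<And>e. e \<in> H \<Longrightarrow> N e = lborel" and \<sigma>: "\<And>e. e \<in> H \<Longrightarrow> \<bar>\<sigma> e\<bar> = 1"
    and h: "\<And>e. e \<in> H \<Longrightarrow> h e \<in> borel_measurable (PiM I N)"
    and indep: "\<And>e w w'. e \<in> H \<Longrightarrow> (\<And>k. \<not> (k \<in> H \<and> rank k \<le> rank e) \<Longrightarrow> w k = w' k) \<Longrightarrow> h e w = h e w'"
    and f: "f \<in> borel_measurable (PiM I N)"
  shows "(\<integral>\<^sup>+w. f (\<lambda>e. if e \<in> H then \<sigma> e * w e + h e w else w e) \<partial>PiM I N) = (\<integral>\<^sup>+w. f w \<partial>PiM I N)"
proof -
  have "finite H" using I H finite_subset by blast
  have "K \<subseteq> H \<Longrightarrow> f \<in> borel_measurable (PiM I N) \<Longrightarrow>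
     (\<integral>\<^sup>+w. f (\<lambda>e. if e \<in> K then \<sigma> e * w e + h e w else w e)  \<partial>PiM I N) = (\<integral>\<^sup>+w. f w \<partial>PiM I N)" if "finite K" for K
    using that
  proof (induction K arbitrary: f rule: finite_ranking_induct[where f = rank, case_names empty insert])
    case empty
    then show ?case by simp
  next
    case (insert e K)
    show ?case
    proof (cases "e \<in> K")
      case True
      then show ?thesis using insert by (simp add: insert_absorb)
    next
      case False
      have eH: "e \<in> H" using insert by auto
      define G where "G = (\<lambda>w k. if k \<in> K then \<sigma> k * w k + h k w else w k)"
      define G1 where "G1 = (\<lambda>w. w(e := \<sigma> e * w e + h e w))"
      note [measurable] = insert.prems(2) h[OF eH]
      have comp: "(\<lambda>w. w e) \<in> PiM I N \<rightarrow>\<^sub>M N e" using eH H by (intro measurable_component_singleton) auto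
      then have [measurable]: "(\<lambda>w. w e) \<in> borel_measurable (PiM I N)" using lb[OF eH] by simp
      have "(\<lambda>w. \<sigma> e * w e + h e w) \<in> PiM I N \<rightarrow>\<^sub>M N e"
        unfolding lb[OF eH] by measurable
      then have "G1 \<in> PiM I N \<rightarrow>\<^sub>M PiM I N"
        unfolding G1_def using eH H by (intro measurable_fun_upd[where J=I]) auto
      then have fG1: "(\<lambda>w. f (G1 w)) \<in> borel_measurable (PiM I N)"
        by (rule measurable_compose) fact
      have "(\<lambda>k. if k \<in> insert e K then \<sigma> k * w k + h k w else w k) = G1 (G w)" for w
      proof -
        have "h e (G w) = h e w"
          using insert.prems insert.hyps by (intro indep[OF eH]) (auto simp: G_def)
        then show ?thesis using False by (auto simp: G1_def G_def fun_eq_iff)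
      qed
      then have "(\<integral>\<^sup>+w. f (\<lambda>k. if k \<in> insert e K then \<sigma> k * w k + h k w else w k) \<partial>PiM I N)
        = (\<integral>\<^sup>+w. f (G1 (G w)) \<partial>PiM I N)" by simp
      \<comment> \<open>The induction hypothesis is applied to the composite
        \<open>f (G1 w)\<close>, so measurability has to be checked only for the single shear
        \<open>G1\<close>.\<close>
      also have "\<dots> = (\<integral>\<^sup>+w. f (G1 w) \<partial>PiM I N)"
        unfolding G_def using insert.prems fG1 by (intro insert.IH) auto
      also have "\<dots> = (\<integral>\<^sup>+w. f w \<partial>PiM I N)"
        unfolding G1_def using eH H insert.prems
        by (intro nn_integral_PiM_shear I N lb \<sigma> h) (auto intro!: indep split: if_splits)
      finally show ?thesis .
    qed
  qed
  from this[OF \<open>finite H\<close> subset_refl f] show ?thesis .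
qed

lemma nn_integral_window_box:
  fixes a :: "'i \<Rightarrow> real"
  assumes "finite J" "0 < \<epsilon>"
  shows "(\<integral>\<^sup>+q. (if \<forall>i\<in>J. a i \<le> q i \<and> q i < a i + \<epsilon> then 1 else 0) \<partial>PiM J (\<lambda>_. lborel)) = ennreal (\<epsilon> ^ card J)"
proof -
  interpret product_sigma_finite "\<lambda>_::'i. lborel :: real measure" ..
  have "(\<integral>\<^sup>+q. (if \<forall>i\<in>J. a i \<le> q i \<and> q i < a i + \<epsilon> then 1 else 0) \<partial>PiM J (\<lambda>_. lborel)) =
    (\<integral>\<^sup>+q. indicator (Pi\<^sub>E J (\<lambda>i. {a i..<a i + \<epsilon>})) q \<partial>PiM J (\<lambda>_. lborel :: real measure))"
    by (intro nn_integral_cong) (auto simp: space_PiM PiE_iff indicator_def)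
  also have "\<dots> = emeasure (PiM J (\<lambda>_. lborel :: real measure)) (Pi\<^sub>E J (\<lambda>i. {a i..<a i + \<epsilon>}))"
    using assms by (intro nn_integral_indicator sets_PiM_I_finite) auto
  also have "\<dots> = (\<Prod>i\<in>J. emeasure lborel {a i..<a i + \<epsilon>})"
    using assms by (intro emeasure_PiM) auto
  also have "\<dots> = ennreal (\<epsilon> ^ card J)"
    using assms by (simp add: ennreal_power)
  finally show ?thesis .
qed

lemma sum_Suc_diff_eq: "(\<Sum>i=1..d. Suc (d - i)) = d * (d + 1) div 2" for d :: nat
proof -
  have "(\<Sum>i=1..d. Suc (d - i)) = (\<Sum>i=1..d. i)"
    by (rule sum.reindex_bij_witness[of _ "\<lambda>i. d + 1 - i" "\<lambda>i. d + 1 - i"]) auto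
  then show ?thesis by (simp add: Sum_Icc_nat)
qed

section \<open>The contribution of a single testimony\<close>

context smoothed_pareto
begin

section \<open>Counting hidden entries; measurability of the reconstruction\<close>

abbreviation cells :: "(nat \<times> nat) set" where "cells \<equiv> {1..d} \<times> {1..n}"

lemma hidden_image: "hidden j = (\<lambda>(i, l). (i, j l)) ` (SIGMA i:{1..d}. {..d - i})"
  by (force simp: hidden_def image_iff)

lemma inj_on_hidden:
  assumes "inj_on j {..<d}"
  shows "inj_on (\<lambda>(i, l). (i, j l)) (SIGMA i:{1..d}. {..d - i})"
  using assms by (auto intro!: inj_onI dest!: inj_onD)

lemma finite_hidden: "finite (hidden j)"
  by (simp add: hidden_image)

lemma card_hidden:
  assumes "inj_on j {..<d}"
  shows "card (hidden j) = d * (d + 1) div 2"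
proof -
  have "card (hidden j) = card (SIGMA i:{1..d}. {..d - i})"
    unfolding hidden_image by (rule card_image[OF inj_on_hidden[OF assms]])
  then show ?thesis using sum_Suc_diff_eq by simp
qed

lemma card_hidden_first:
  assumes "inj_on j {..<d}"
  shows "card (hidden j \<inter> {e. snd e = j 0}) = d"
proof -
  have "hidden j \<inter> {e. snd e = j 0} = (\<lambda>i. (i, j 0)) ` {1..d}"
  proof (intro set_eqI iffI)
    fix e assume "e \<in> (\<lambda>i. (i, j 0)) ` {1..d}"
    then obtain i where "e = (i, j 0)" "1 \<le> i" "0 + i \<le> d" by auto
    then show "e \<in> hidden j \<inter> {e. snd e = j 0}"
      unfolding hidden_def by fastforce
  qed (auto simp: hidden_def)
  then show ?thesis by (simp add: card_image inj_on_def)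
qed

lemma hidden_subset_cells:
  assumes "j ` {..<d} \<subseteq> {1..n}"
  shows "hidden j \<subseteq> cells"
  using assms by (auto simp: hidden_def image_subset_iff)

text \<open>This lemma and the next two let the matrix depend on a parameter in any space
  \<open>K\<close>, so that they serve for matrices and thresholds on the space of pairs
  \<open>(q, w)\<close> and for thresholds as functions of \<open>q\<close> alone.\<close>

lemma measurable_visible:
  assumes "\<And>e. e \<in> cells \<Longrightarrow> (\<lambda>k. \<omega> k e) \<in> borel_measurable K" "i \<in> {1..d+1}"
  shows "(\<lambda>k. visible j (\<omega> k) i y) \<in> borel_measurable K"
proof (cases "i = d + 1")
  case False
  then have "(\<lambda>k. \<Sum>m\<in>{1..n} - j ` {l. l + i \<le> d}. \<omega> k (i, m) * y m) \<in> borel_measurable K"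
    using assms by (intro borel_measurable_sum borel_measurable_times) auto
  then show ?thesis using False by (simp add: visible_def)
qed (simp add: visible_def)

lemma measurable_cand:
  assumes \<omega>: "\<And>e. e \<in> cells \<Longrightarrow> (\<lambda>k. \<omega> k e) \<in> borel_measurable K"
    and j: "j ` {..<d} \<subseteq> {1..n}" and "t \<le> d"
  shows "Measurable.pred K (\<lambda>k. y \<in> cand j b (\<omega> k) t)"
  using \<open>t \<le> d\<close>
proof (induction t arbitrary: y)
  case 0
  then show ?case by simp
next
  case (Suc t)
  have IH[measurable]: "Measurable.pred K (\<lambda>k. z \<in> cand j b (\<omega> k) t)" for z
    using Suc by simp
  have [measurable]: "(\<lambda>k. visible j (\<omega> k) (d + 1 - t) z) \<in> borel_measurable K" for z
    using Suc.prems by (intro measurable_visible \<omega>) auto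
  have p[measurable]: "Measurable.pred K (\<lambda>k. \<forall>i\<in>{1..d - t}. \<omega> k (i, j t) < visible j (\<omega> k) i z)" for z
    using Suc.prems j
    by (intro pred_intros_finite borel_measurable_pred_less measurable_visible \<omega>) (auto simp: image_subset_iff)
  have fin: "finite (cls j b t)" using finite_S by (simp add: cls_def)
  \<comment> \<open>The quantifier is moved to the fixed finite set \<open>cls j b t\<close>,
    because its original range depends on \<open>k\<close>.\<close>
  have "Measurable.pred K (\<lambda>k. y \<in> cand j b (\<omega> k) t \<and> (\<forall>z\<in>cls j b t. z \<in> cand j b (\<omega> k) t \<longrightarrow>
      (\<forall>i\<in>{1..d - t}. \<omega> k (i, j t) < visible j (\<omega> k) i z) \<longrightarrow>
        visible j (\<omega> k) (d + 1 - t) z < visible j (\<omega> k) (d + 1 - t) y))"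
    using fin by (intro pred_intros_logic pred_intros_finite IH p borel_measurable_pred_less) measurable
  also have "(\<lambda>k. y \<in> cand j b (\<omega> k) t \<and> (\<forall>z\<in>cls j b t. z \<in> cand j b (\<omega> k) t \<longrightarrow>
      (\<forall>i\<in>{1..d - t}. \<omega> k (i, j t) < visible j (\<omega> k) i z) \<longrightarrow>
        visible j (\<omega> k) (d + 1 - t) z < visible j (\<omega> k) (d + 1 - t) y)) = (\<lambda>k. y \<in> cand j b (\<omega> k) (Suc t))"
    by auto
  finally show ?case .
qed

lemma measurable_winner:
  assumes \<omega>: "\<And>e. e \<in> cells \<Longrightarrow> (\<lambda>k. \<omega> k e) \<in> borel_measurable K"
    and j: "j ` {..<d} \<subseteq> {1..n}"
  shows "Measurable.pred K (\<lambda>k. winner j b (\<omega> k) x)"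
proof -
  have [measurable]: "Measurable.pred K (\<lambda>k. y \<in> cand j b (\<omega> k) d)" for y
    by (rule measurable_cand[OF \<omega> j]) auto
  have [measurable]: "(\<lambda>k. visible j (\<omega> k) 1 z) \<in> borel_measurable K" for z
    using dn by (intro measurable_visible \<omega>) auto
  have fin: "finite (cls j b d)" using finite_S by (simp add: cls_def)
  have "Measurable.pred K (\<lambda>k. (x \<in> cand j b (\<omega> k) d \<and> x \<in> cls j b d) \<and>
     (\<forall>y\<in>cls j b d. y \<in> cand j b (\<omega> k) d \<longrightarrow> y \<noteq> x \<longrightarrow> visible j (\<omega> k) 1 y < visible j (\<omega> k) 1 x))"
    using fin by (intro pred_intros_logic pred_intros_finite borel_measurable_pred_less) measurable
  also have "(\<lambda>k. (x \<in> cand j b (\<omega> k) d \<and> x \<in> cls j b d) \<and>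
     (\<forall>y\<in>cls j b d. y \<in> cand j b (\<omega> k) d \<longrightarrow> y \<noteq> x \<longrightarrow> visible j (\<omega> k) 1 y < visible j (\<omega> k) 1 x))
     = (\<lambda>k. winner j b (\<omega> k) x)"
    by (auto simp: winner_def fun_eq_iff)
  finally show ?thesis .
qed

section \<open>The region containing the thresholds\<close>

definition window :: "real \<Rightarrow> (nat \<Rightarrow> nat) \<Rightarrow> (nat \<Rightarrow> real) \<Rightarrow> (nat \<times> nat \<Rightarrow> real) \<Rightarrow> (nat \<Rightarrow> real) \<Rightarrow> bool" where
  "window \<epsilon> j q w x \<longleftrightarrow> (\<forall>i\<in>{1..d}. visible j w i x \<le> q i \<and> q i < visible j w i x + \<epsilon>)"

definition radius :: "(nat \<Rightarrow> nat) \<Rightarrow> nat \<times> nat \<Rightarrow> real" where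
  "radius j e = (if snd e = j 0 then real n + 1 else real d)"

text \<open>The thresholds of a row lie close to each other, so all but the first are measured relative to
  the first.\<close>

definition centre :: "(nat \<Rightarrow> nat) \<Rightarrow> (nat \<times> nat \<Rightarrow> real) \<Rightarrow> nat \<times> nat \<Rightarrow> real" where
  "centre j w e = (if e \<in> hidden j \<inter> {e. snd e \<noteq> j 0} then 1 * w e + - w (fst e, j 0) else w e)"

lemma pattern_diff:
  assumes "b \<in> {(t, l). t \<le> l \<and> l < d} \<rightarrow> {0, 1}" "t \<le> d" "t' \<le> d" "l < d"
  shows "\<bar>pattern b t l - pattern b t' l\<bar> \<le> 1"
proof -
  have "pattern b t l \<in> {0,1}" if "t \<le> d" for t
    using funcset_mem[OF assms(1), of "(l,l)"] funcset_mem[OF assms(1), of "(t,l)"] assms(4) that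
    by (auto simp: pattern_def)
  from this[OF assms(2)] this[OF assms(3)] show ?thesis by auto
qed

text \<open>For column \<open>j 0\<close>, the visible value has \<open>n - card L\<close> terms and
  the correction \<open>card L\<close> terms, all of modulus at most 1, and the window adds at most
  1: in total \<open>n + 1\<close>. In the difference of two thresholds of a row, \<open>q i\<close>
  cancels and \<open>card L \<le> d\<close> such terms remain.\<close>

lemma thresholds_in_region:
  assumes j: "inj_on j {..<d}" "j ` {..<d} \<subseteq> {1..n}"
    and b: "b \<in> {(t, l). t \<le> l \<and> l < d} \<rightarrow> {0, 1}"
    and "x \<in> S" and q: "window \<epsilon> j q w x" and w: "\<And>e. e \<in> cells \<Longrightarrow> \<bar>w e\<bar> \<le> 1"
    and "\<epsilon> \<le> 1" and e: "e \<in> hidden j"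
  shows "\<bar>centre j (thresholds j b q w) e\<bar> \<le> radius j e"
proof -
  obtain i t where e': "e = (i, j t)" "1 \<le> i" "t + i \<le> d" using e by (auto simp: hidden_def)
  then have i: "i \<in> {1..d}" by auto
  define L where "L = {l. l + i \<le> d}"
  have L: "L \<subseteq> {..<d}" using i by (auto simp: L_def)
  then have finL: "finite L" using finite_subset by blast
  have summand: "\<bar>(pattern b s l - pattern b s' l) * w (i, j l)\<bar> \<le> 1" if "l \<in> L" "s \<le> d" "s' \<le> d" for l s s'
  proof -
    have "l < d" using that L by auto
    then have "\<bar>w (i, j l)\<bar> \<le> 1" using j(2) i by (intro w) auto
    then show ?thesis using pattern_diff[OF b that(2,3) \<open>l < d\<close>]
      by (simp add: abs_mult mult_le_one)
  qed
  have sumb: "\<bar>\<Sum>l\<in>L. (pattern b s l - pattern b s' l) * w (i, j l)\<bar> \<le> real (card L)"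
    if "s \<le> d" "s' \<le> d" for s s'
    using order_trans[OF sum_abs sum_bounded_above[of L "\<lambda>l. \<bar>(pattern b s l - pattern b s' l) * w (i, j l)\<bar>" 1]]
      summand that by simp
  have tj: "thresholds j b q w (i, j s) = q i + (\<Sum>l\<in>L. (pattern b d l - pattern b s l) * w (i, j l))"
    if "s + i \<le> d" for s
    unfolding L_def using j e' that by (intro thresholds_hidden) auto
  show ?thesis
  proof (cases "t = 0")
    case True
    have "\<bar>visible j w i x\<bar> \<le> (\<Sum>m\<in>{1..n} - j ` L. \<bar>w (i, m) * x m\<bar>)"
      using i by (simp add: visible_def L_def)
    also have "\<dots> \<le> (\<Sum>m\<in>{1..n} - j ` L. 1)"
    proof (rule sum_mono)
      fix m assume m: "m \<in> {1..n} - j ` L"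
      have "\<bar>w (i,m)\<bar> \<le> 1" using m i by (intro w) auto
      moreover have "x m = 0 \<or> x m = 1"
        using m \<open>x \<in> S\<close> S by (intro binary_vectors_cases[of x n]) auto
      ultimately show "\<bar>w (i, m) * x m\<bar> \<le> 1" by auto
    qed
    also have "\<dots> = real n - real (card L)"
    proof -
      have "card (j ` L) = card L" using j L by (meson card_image inj_on_subset)
      moreover have "j ` L \<subseteq> {1..n}" using j L by auto
      moreover from this have "card (j ` L) \<le> n" using card_mono[of "{1..n}" "j ` L"] by simp
      ultimately show ?thesis using finL by (simp add: card_Diff_subset of_nat_diff)
    qed
    finally have "\<bar>visible j w i x\<bar> \<le> real n - real (card L)" .
    moreover have "visible j w i x \<le> q i" "q i < visible j w i x + \<epsilon>"
      using q i by (auto simp: window_def)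
    moreover have "\<bar>\<Sum>l\<in>L. (pattern b d l - pattern b 0 l) * w (i, j l)\<bar> \<le> real (card L)"
      by (rule sumb) auto
    ultimately have "\<bar>thresholds j b q w (i, j 0)\<bar> \<le> real n + 1"
      using tj[of 0] i \<open>\<epsilon> \<le> 1\<close> by auto
    then show ?thesis using True by (simp add: centre_def radius_def e')
  next
    case False
    have "j t \<noteq> j 0" using False j e' dn by (auto dest!: inj_onD)
    then have "centre j (thresholds j b q w) e = thresholds j b q w (i, j t) - thresholds j b q w (i, j 0)"
      using e e' by (simp add: centre_def)
    also have "\<dots> = (\<Sum>l\<in>L. (pattern b d l - pattern b t l) * w (i, j l)) - (\<Sum>l\<in>L. (pattern b d l - pattern b 0 l) * w (i, j l))"
      using tj[of t] tj[of 0] e' by simp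
    \<comment> \<open>The bits of \<open>x\<close> cancel as well, which gives \<open>card L\<close>
      instead of twice that.\<close>
    also have "\<dots> = (\<Sum>l\<in>L. (pattern b 0 l - pattern b t l) * w (i, j l))"
      by (simp add: sum_subtractf[symmetric] algebra_simps)
    finally have "\<bar>centre j (thresholds j b q w) e\<bar> \<le> real (card L)"
      using sumb[of 0 t] e' by simp
    also have "\<dots> \<le> real d" using card_mono[OF _ L] by simp
    finally show ?thesis using \<open>j t \<noteq> j 0\<close> by (simp add: radius_def e')
  qed
qed

end

section \<open>Change of variables from hidden entries to thresholds\<close>

context smoothed_pareto
begin

text \<open>At column position \<open>t\<close>, the bits of \<open>z\<^sub>t\<close> and
  \<open>x\<close> agree before \<open>t\<close>, so the terms with \<open>l < t\<close> vanish. The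
  term \<open>l = t\<close> is the diagonal one, and the rest reads only later columns.\<close>

lemma thresholds_triangular:
  assumes j: "inj_on j {..<d}"
  defines "pos \<equiv> \<lambda>e. the_inv_into {..<d} j (snd e)"
  shows "thresholds j b q w = (\<lambda>e. if e \<in> hidden j then
     (pattern b d (pos e) - pattern b (pos e) (pos e)) * w e +
       (q (fst e) + (\<Sum>l | pos e < l \<and> l + fst e \<le> d. (pattern b d l - pattern b (pos e) l) * w (fst e, j l)))
     else w e)"
proof
  fix e
  show "thresholds j b q w e = (if e \<in> hidden j then
     (pattern b d (pos e) - pattern b (pos e) (pos e)) * w e +
       (q (fst e) + (\<Sum>l | pos e < l \<and> l + fst e \<le> d. (pattern b d l - pattern b (pos e) l) * w (fst e, j l)))
     else w e)"
  proof (cases "e \<in> hidden j")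
    case True
    then obtain i t where e: "e = (i, j t)" "1 \<le> i" "t + i \<le> d" by (auto simp: hidden_def)
    have t: "pos e = t" unfolding pos_def e(1) using j e by (auto intro: the_inv_into_f_f)
    have fin: "finite {l. l + i \<le> d}" by (rule finite_subset[of _ "{..d}"]) auto
    have "(\<Sum>l | l + i \<le> d. (pattern b d l - pattern b t l) * w (i, j l)) =
      (\<Sum>l\<in>insert t {l. t < l \<and> l + i \<le> d}. (pattern b d l - pattern b t l) * w (i, j l))"
      using fin e by (intro sum.mono_neutral_right) (auto simp: pattern_def)
    also have "\<dots> = (pattern b d t - pattern b t t) * w (i, j t) +
       (\<Sum>l | t < l \<and> l + i \<le> d. (pattern b d l - pattern b t l) * w (i, j l))"
      using finite_subset[OF _ fin, of "{l. t < l \<and> l + i \<le> d}"] by (subst sum.insert) auto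
    finally show ?thesis
      using thresholds_hidden[OF j e(2,3), of b q w] True t unfolding e(1) by simp
  qed (simp add: thresholds_def)
qed

lemma nn_integral_thresholds:
  assumes j: "inj_on j {..<d}" "j ` {..<d} \<subseteq> {1..n}"
    and b: "b \<in> {(t, l). t \<le> l \<and> l < d} \<rightarrow> {0, 1}"
    and N: "product_sigma_finite N" "\<And>e. sets (N e) = sets borel" "\<And>e. e \<in> hidden j \<Longrightarrow> N e = lborel"
    and f: "f \<in> borel_measurable (PiM cells N)"
  shows "(\<integral>\<^sup>+w. f (thresholds j b q w) \<partial>PiM cells N) = (\<integral>\<^sup>+w. f w \<partial>PiM cells N)"
proof -
  define pos where "pos = (\<lambda>e::nat\<times>nat. the_inv_into {..<d} j (snd e))"
  have comp: "(\<lambda>w. w e) \<in> borel_measurable (PiM cells N)" if "e \<in> cells" for e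
    using measurable_component_singleton[OF that, of N] N(2) by (simp cong: measurable_cong_sets)
  have tixj: "pos (i, j l) = l" if "l < d" for i l
    using that j by (simp add: pos_def the_inv_into_f_f)
  have thresholds_eq: "thresholds j b q = (\<lambda>w e. if e \<in> hidden j then
     (pattern b d (pos e) - pattern b (pos e) (pos e)) * w e +
       (q (fst e) + (\<Sum>l | pos e < l \<and> l + fst e \<le> d. (pattern b d l - pattern b (pos e) l) * w (fst e, j l)))
     else w e)"
    unfolding pos_def by (rule ext, rule thresholds_triangular[OF j(1)])
  show ?thesis
    unfolding thresholds_eq
  proof (rule nn_integral_PiM_triangular[where rank = pos and f = f and H = "hidden j"
      and \<sigma> = "\<lambda>e. pattern b d (pos e) - pattern b (pos e) (pos e)"
      and h = "\<lambda>e w. q (fst e) + (\<Sum>l | pos e < l \<and> l + fst e \<le> d. (pattern b d l - pattern b (pos e) l) * w (fst e, j l))"])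
    show "finite cells" by simp
    show "hidden j \<subseteq> cells" using hidden_subset_cells[OF j(2)] .
    fix e assume "e \<in> hidden j"
    then obtain i t where e: "e = (i, j t)" "1 \<le> i" "t + i \<le> d" by (auto simp: hidden_def)
    have t: "pos e = t" using e tixj by auto
    \<comment> \<open>The diagonal coefficient is \<open>b (t, t) - (1 - b (t, t))\<close>, hence 1
      or -1.\<close>
    have "b (t, t) \<in> {0, 1}" using e by (intro funcset_mem[OF b]) auto
    then show "\<bar>pattern b d (pos e) - pattern b (pos e) (pos e)\<bar> = 1"
      using e t by (auto simp: pattern_def)
    show "(\<lambda>w. q (fst e) + (\<Sum>l | pos e < l \<and> l + fst e \<le> d. (pattern b d l - pattern b (pos e) l) * w (fst e, j l)))
         \<in> borel_measurable (PiM cells N)"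
      using e j(2)
      by (intro borel_measurable_add borel_measurable_sum borel_measurable_times comp borel_measurable_const) (auto simp: image_subset_iff)
    fix w w' :: "nat \<times> nat \<Rightarrow> real"
    assume eq: "\<And>k. \<not> (k \<in> hidden j \<and> pos k \<le> pos e) \<Longrightarrow> w k = w' k"
    have "w (i, j l) = w' (i, j l)" if "t < l" "l + i \<le> d" for l
      using that e t tixj by (intro eq) auto
    then show "q (fst e) + (\<Sum>l | pos e < l \<and> l + fst e \<le> d. (pattern b d l - pattern b (pos e) l) * w (fst e, j l)) =
       q (fst e) + (\<Sum>l | pos e < l \<and> l + fst e \<le> d. (pattern b d l - pattern b (pos e) l) * w' (fst e, j l))"
      unfolding t by (simp add: e(1))
  qed (use N f in auto)
qed

text \<open>Subtracting the first threshold of each row is a shear that turns the region into a box: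
  \<open>d\<close> sides of length \<open>2 * (n + 1)\<close>, the other hidden sides of length
  \<open>2 * d\<close>, and mass 1 in every coordinate that is not hidden.\<close>

lemma nn_integral_region:
  assumes j: "inj_on j {..<d}" "j ` {..<d} \<subseteq> {1..n}"
    and N: "product_sigma_finite N" "\<And>e. sets (N e) = sets borel" "\<And>e. e \<in> hidden j \<Longrightarrow> N e = lborel"
      "\<And>e. e \<notin> hidden j \<Longrightarrow> prob_space (N e)"
  shows "(\<integral>\<^sup>+w. (if \<forall>e\<in>hidden j. \<bar>centre j w e\<bar> \<le> radius j e then 1 else 0) \<partial>PiM cells N) =
     ennreal ((2 * (real n + 1)) ^ d * (2 * real d) ^ (d * (d + 1) div 2 - d))"
proof -
  interpret N: product_sigma_finite N by fact
  have comp: "(\<lambda>w. w e) \<in> borel_measurable (PiM cells N)" if "e \<in> cells" for e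
    using measurable_component_singleton[OF that, of N] N(2) by (simp cong: measurable_cong_sets)
  have sub: "hidden j \<subseteq> cells" using hidden_subset_cells[OF j(2)] .
  have j0: "j 0 \<in> {1..n}" using j dn by (auto simp: image_subset_iff)
  define R where "R = (\<lambda>e. if e \<in> hidden j then {- radius j e..radius j e} else UNIV)"
  define f where "f = (\<lambda>w. if \<forall>e\<in>hidden j. \<bar>w e\<bar> \<le> radius j e then 1 else 0 :: ennreal)"
  have f_ind: "f w = indicator (Pi\<^sub>E cells R) w" if "w \<in> space (PiM cells N)" for w
  proof -
    have "w \<in> extensional cells" using that by (auto simp: space_PiM PiE_iff)
    then have "w \<in> Pi\<^sub>E cells R \<longleftrightarrow> (\<forall>e\<in>cells. w e \<in> R e)" by (simp add: PiE_iff)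
    also have "\<dots> \<longleftrightarrow> (\<forall>e\<in>hidden j. w e \<in> R e)" using sub by (auto simp: R_def)
    also have "\<dots> \<longleftrightarrow> (\<forall>e\<in>hidden j. \<bar>w e\<bar> \<le> radius j e)" by (auto simp: R_def abs_le_iff)
    finally show ?thesis by (simp add: f_def indicator_def)
  qed
  have R: "R e \<in> sets (N e)" for e by (simp add: R_def N(2))
  have "(\<integral>\<^sup>+w. f (centre j w) \<partial>PiM cells N) = (\<integral>\<^sup>+w. f w \<partial>PiM cells N)"
    unfolding centre_def
  \<comment> \<open>A constant rank suffices, since the shift reads only
    \<open>(fst e, j 0)\<close>, which lies outside the modified set. The shape
    \<open>1 * w e + - w (fst e, j 0)\<close> in \<open>centre\<close> is chosen to match this
    rule.\<close>
  proof (rule nn_integral_PiM_triangular[where rank = "\<lambda>_. 0" and f = f and H = "hidden j \<inter> {e. snd e \<noteq> j 0}"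
      and \<sigma> = "\<lambda>_. 1" and h = "\<lambda>e w. - w (fst e, j 0)"])
    have "Measurable.pred (PiM cells N) (\<lambda>w. \<forall>e\<in>hidden j. \<bar>w e\<bar> \<le> radius j e)"
      using comp sub by (intro pred_intros_finite finite_hidden) (auto intro!: borel_measurable_le)
    then show "f \<in> borel_measurable (PiM cells N)" unfolding f_def by measurable
    fix e assume e: "e \<in> hidden j \<inter> {e. snd e \<noteq> j 0}"
    then show "(\<lambda>w. - w (fst e, j 0)) \<in> borel_measurable (PiM cells N)"
      using sub j0 by (intro borel_measurable_uminus comp) auto
  qed (use N sub in auto)
  also have "\<dots> = (\<integral>\<^sup>+w. indicator (Pi\<^sub>E cells R) w \<partial>PiM cells N)"
    using f_ind by (intro nn_integral_cong) auto
  also have "\<dots> = emeasure (PiM cells N) (Pi\<^sub>E cells R)"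
    using R by (intro nn_integral_indicator sets_PiM_I_finite) auto
  also have "\<dots> = (\<Prod>e\<in>cells. emeasure (N e) (R e))"
    using R by (intro N.emeasure_PiM) auto
  also have "\<dots> = (\<Prod>e\<in>hidden j. emeasure (N e) (R e))"
  proof (rule prod.mono_neutral_right)
    show "\<forall>e\<in>cells - hidden j. emeasure (N e) (R e) = 1"
    proof
      fix e assume "e \<in> cells - hidden j"
      then show "emeasure (N e) (R e) = 1"
        using prob_space.emeasure_space_1[OF N(4), of e] sets_eq_imp_space_eq[OF N(2), of e] by (simp add: R_def)
    qed
  qed (use sub in auto)
  also have "\<dots> = (\<Prod>e\<in>hidden j. ennreal (if snd e = j 0 then 2 * (real n + 1) else 2 * real d))"
  proof (rule prod.cong)
    fix e assume "e \<in> hidden j"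
    then show "emeasure (N e) (R e) = ennreal (if snd e = j 0 then 2 * (real n + 1) else 2 * real d)"
      by (simp add: R_def N(3) radius_def algebra_simps)
  qed simp
  also have "\<dots> = ennreal (\<Prod>e\<in>hidden j. if snd e = j 0 then 2 * (real n + 1) else 2 * real d)"
    by (rule prod_ennreal) auto
  also have "(\<Prod>e\<in>hidden j. if snd e = j 0 then 2 * (real n + 1) else 2 * real d) =
     (2 * (real n + 1)) ^ card (hidden j \<inter> {e. snd e = j 0}) * (2 * real d) ^ card (hidden j \<inter> - {e. snd e = j 0})"
    using finite_hidden by (subst prod.If_cases) auto
  also have "card (hidden j \<inter> - {e. snd e = j 0}) = card (hidden j) - card (hidden j \<inter> {e. snd e = j 0})"
    using finite_hidden by (subst card_Diff_subset_Int[symmetric]) (auto simp: Diff_eq)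
  finally show ?thesis
    unfolding f_def card_hidden[OF j(1)] card_hidden_first[OF j(1)] .
qed

text \<open>With the thresholds as variables the winner does not depend on \<open>q\<close>, so at
  most one vector contributes, and its window is a box of volume \<open>\<epsilon> ^ d\<close>.
  Later \<open>P\<close> says that \<open>w\<close> lies in the region.\<close>

lemma nn_integral_windows_le:
  assumes "0 < \<epsilon>"
  shows "(\<integral>\<^sup>+q. (\<Sum>x\<in>S. if window \<epsilon> j q w x \<and> winner j b w x \<and> P then 1 else 0) \<partial>PiM {1..d} (\<lambda>_. lborel))
     \<le> ennreal (\<epsilon> ^ d) * (if P then 1 else 0)"
proof (cases "P \<and> (\<exists>x\<in>S. winner j b w x)")
  case True
  then obtain x where x: "x \<in> S" "winner j b w x" and P by blast
  have "(\<Sum>y\<in>S. if window \<epsilon> j q w y \<and> winner j b w y \<and> P then 1 else 0) =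
     (if \<forall>i\<in>{1..d}. visible j w i x \<le> q i \<and> q i < visible j w i x + \<epsilon> then 1 else 0 :: ennreal)" for q
  proof -
    have "(\<Sum>y\<in>S. if window \<epsilon> j q w y \<and> winner j b w y \<and> P then 1 else 0) =
       (\<Sum>y\<in>S. if y = x then (if window \<epsilon> j q w x then 1 else 0) else 0 :: ennreal)"
      using x \<open>P\<close> winner_unique by (intro sum.cong) auto
    then show ?thesis using x finite_S by (simp add: window_def)
  qed
  then show ?thesis
    using nn_integral_window_box[of "{1..d}" \<epsilon> "\<lambda>i. visible j w i x"] assms \<open>P\<close> by simp
next
  case False
  then have "(\<Sum>x\<in>S. if window \<epsilon> j q w x \<and> winner j b w x \<and> P then 1 else 0 :: ennreal) = 0" for q
    by (intro sum.neutral) auto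
  then show ?thesis by simp
qed

text \<open>The bound on the entries, which holds almost surely, is built in because it confines the
  thresholds.\<close>

definition explained :: "real \<Rightarrow> (nat \<Rightarrow> nat) \<Rightarrow> (nat \<times> nat \<Rightarrow> real) \<Rightarrow> (nat \<Rightarrow> real) \<Rightarrow> (nat \<times> nat \<Rightarrow> real) \<Rightarrow> (nat \<Rightarrow> real) \<Rightarrow> bool" where
  "explained \<epsilon> j b q w x \<longleftrightarrow>
     window \<epsilon> j q w x \<and> winner j b (thresholds j b q w) x \<and> (\<forall>e\<in>cells. \<bar>w e\<bar> \<le> 1)"

lemma
  fixes N :: "nat \<times> nat \<Rightarrow> real measure"
  assumes j: "j ` {..<d} \<subseteq> {1..n}" and N: "\<And>e. sets (N e) = sets borel"
  defines "K \<equiv> PiM {1..d} (\<lambda>_. lborel :: real measure) \<Otimes>\<^sub>M PiM cells N"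
  shows measurable_snd_cell: "\<And>e. e \<in> cells \<Longrightarrow> (\<lambda>k. snd k e) \<in> borel_measurable K"
    and measurable_window: "Measurable.pred K (\<lambda>k. window \<epsilon> j (fst k) (snd k) x)"
    and measurable_explained: "Measurable.pred K (\<lambda>k. explained \<epsilon> j b (fst k) (snd k) x)"
proof -
  have qm: "(\<lambda>k. fst k i) \<in> borel_measurable K" if "i \<in> {1..d}" for i
    using measurable_compose[OF measurable_fst measurable_component_singleton[OF that, of "\<lambda>_. lborel"]]
    by (simp add: K_def)
  show wm: "(\<lambda>k. snd k e) \<in> borel_measurable K" if "e \<in> cells" for e
    using measurable_compose[OF measurable_snd measurable_component_singleton[OF that, of N]] N
    by (simp add: K_def cong: measurable_cong_sets)
  have tm: "(\<lambda>k. thresholds j b (fst k) (snd k) e) \<in> borel_measurable K" if "e \<in> cells" for e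
  proof (cases "e \<in> hidden j")
    case True
    have "(\<lambda>k. fst k (fst e) + (\<Sum>l | l + fst e \<le> d. (pattern b d l - pattern b (the_inv_into {..<d} j (snd e)) l) * snd k (fst e, j l)))
       \<in> borel_measurable K"
      using that j by (intro borel_measurable_add borel_measurable_sum borel_measurable_times borel_measurable_const qm wm) (auto simp: image_subset_iff)
    then show ?thesis using True by (simp add: thresholds_def)
  qed (use wm that in \<open>simp add: thresholds_def\<close>)
  have pm: "(\<lambda>k. visible j (snd k) i x) \<in> borel_measurable K" if "i \<in> {1..d}" for i
    using that by (intro measurable_visible wm) auto
  show win: "Measurable.pred K (\<lambda>k. window \<epsilon> j (fst k) (snd k) x)"
    unfolding window_def using qm pm
    by (intro pred_intros_finite pred_intros_logic borel_measurable_pred_less) (auto intro!: borel_measurable_le)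
  have "Measurable.pred K (\<lambda>k. \<forall>e\<in>cells. \<bar>snd k e\<bar> \<le> 1)"
    using wm by (intro pred_intros_finite) (auto intro!: borel_measurable_le)
  moreover have "Measurable.pred K (\<lambda>k. winner j b (thresholds j b (fst k) (snd k)) x)"
    using tm by (intro measurable_winner j)
  ultimately show "Measurable.pred K (\<lambda>k. explained \<epsilon> j b (fst k) (snd k) x)"
    unfolding explained_def using win by (intro pred_intros_logic)
qed

lemma measurable_nn_integral_explained:
  fixes N :: "nat \<times> nat \<Rightarrow> real measure"
  assumes j: "j ` {..<d} \<subseteq> {1..n}" and N: "\<And>e. sets (N e) = sets borel"
  shows "(\<lambda>w. \<integral>\<^sup>+q. (\<Sum>x\<in>S. if explained \<epsilon> j b q w x then 1 else 0) \<partial>PiM {1..d} (\<lambda>_. lborel)) \<in> borel_measurable (PiM cells N)"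
proof -
  interpret product_sigma_finite "\<lambda>_::nat. lborel :: real measure" ..
  interpret Q: sigma_finite_measure "PiM {1..d} (\<lambda>_. lborel :: real measure)"
    by (rule sigma_finite) simp
  have [measurable]: "Measurable.pred (PiM {1..d} (\<lambda>_. lborel :: real measure) \<Otimes>\<^sub>M PiM cells N)
      (\<lambda>k. explained \<epsilon> j b (fst k) (snd k) x)" for x
    by (rule measurable_explained[OF j N])
  have "(\<lambda>k. \<Sum>x\<in>S. if explained \<epsilon> j b (fst k) (snd k) x then 1 else 0 :: ennreal)
      \<in> borel_measurable (PiM {1..d} (\<lambda>_. lborel) \<Otimes>\<^sub>M PiM cells N)" by measurable
  from measurable_compose[OF measurable_pair_swap' this]
  have "(\<lambda>(w, q). \<Sum>x\<in>S. if explained \<epsilon> j b q w x then 1 else 0 :: ennreal)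
      \<in> borel_measurable (PiM cells N \<Otimes>\<^sub>M PiM {1..d} (\<lambda>_. lborel))" by (simp add: split_beta)
  then show ?thesis by (rule Q.borel_measurable_nn_integral)
qed

text \<open>The substitution works in \<open>w\<close> for fixed \<open>q\<close>, while the gain
  \<open>\<epsilon> ^ d\<close> comes from integrating \<open>q\<close> for fixed thresholds; hence
  the order of integration is exchanged twice.\<close>

lemma testimony_bound:
  assumes j: "inj_on j {..<d}" "j ` {..<d} \<subseteq> {1..n}"
    and b: "b \<in> {(t, l). t \<le> l \<and> l < d} \<rightarrow> {0, 1}"
    and D: "\<And>e. prob_space (D e)" "\<And>e. sets (D e) = sets borel"
    and dom: "\<And>e f. e \<in> cells \<Longrightarrow> f \<in> borel_measurable borel \<Longrightarrow>
        (\<integral>\<^sup>+x. f x \<partial>D e) \<le> ennreal \<phi> * (\<integral>\<^sup>+x. f x \<partial>lborel)"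
    and pos: "0 < \<phi>" "0 < \<epsilon>" "\<epsilon> \<le> 1"
  shows "(\<integral>\<^sup>+w. \<integral>\<^sup>+q. (\<Sum>x\<in>S. if explained \<epsilon> j b q w x then 1 else 0)
            \<partial>PiM {1..d} (\<lambda>_. lborel) \<partial>PiM cells D)
     \<le> ennreal (\<phi> ^ (d * (d + 1) div 2) * (\<epsilon> ^ d * ((2 * (real n + 1)) ^ d * (2 * real d) ^ (d * (d + 1) div 2 - d))))"
proof -
  \<comment> \<open>Only the hidden entries pass to Lebesgue measure, at one factor \<phi> each; the
    others keep their distribution.\<close>
  define N where "N = (\<lambda>e. if e \<in> hidden j then lborel else D e)"
  define Q where "Q = PiM {1..d} (\<lambda>_. lborel :: real measure)"
  define reg where "reg = (\<lambda>w. \<forall>e\<in>hidden j. \<bar>centre j w e\<bar> \<le> radius j e)"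
  define F where "F = (\<lambda>q w. \<Sum>x\<in>S. if explained \<epsilon> j b q w x then 1 else 0 :: ennreal)"
  \<comment> \<open>\<open>F\<close> in terms of the thresholds: the window condition carries over
    because visible values ignore hidden entries, and \<open>reg\<close> records where the
    thresholds lie.\<close>
  define G where "G = (\<lambda>q w. \<Sum>x\<in>S. if window \<epsilon> j q w x \<and> winner j b w x \<and> reg w then 1 else 0 :: ennreal)"
  have sub: "hidden j \<subseteq> cells" using hidden_subset_cells[OF j(2)] .
  have setsN: "sets (N e) = sets borel" for e by (simp add: N_def D)
  have psD: "product_sigma_finite D"
    by (simp add: product_sigma_finite_def prob_space_imp_sigma_finite D)
  have psN: "product_sigma_finite N"
    by (simp add: product_sigma_finite_def prob_space_imp_sigma_finite D N_def sigma_finite_lborel)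
  have psL: "product_sigma_finite (\<lambda>_::nat. lborel :: real measure)"
    by (simp add: product_sigma_finite_def sigma_finite_lborel)
  interpret PN: sigma_finite_measure "PiM cells N"
    by (rule product_sigma_finite.sigma_finite[OF psN]) simp
  interpret PQ: sigma_finite_measure Q
    unfolding Q_def by (rule product_sigma_finite.sigma_finite[OF psL]) simp
  interpret QN: pair_sigma_finite Q "PiM cells N" ..
  have wm: "(\<lambda>k. snd k e) \<in> borel_measurable (Q \<Otimes>\<^sub>M PiM cells N)" if "e \<in> cells" for e
    unfolding Q_def by (rule measurable_snd_cell[OF j(2) setsN that])
  have [measurable]: "Measurable.pred (Q \<Otimes>\<^sub>M PiM cells N) (\<lambda>k. window \<epsilon> j (fst k) (snd k) x)"
    "Measurable.pred (Q \<Otimes>\<^sub>M PiM cells N) (\<lambda>k. explained \<epsilon> j b (fst k) (snd k) x)" for x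
    unfolding Q_def by (rule measurable_window[OF j(2) setsN], rule measurable_explained[OF j(2) setsN])
  have cm: "(\<lambda>k. centre j (snd k) e) \<in> borel_measurable (Q \<Otimes>\<^sub>M PiM cells N)" if "e \<in> hidden j" for e
  proof -
    have "e \<in> cells" "(fst e, j 0) \<in> cells" using that sub j dn by (auto simp: image_subset_iff)
    then show ?thesis unfolding centre_def using wm by (cases "e \<in> hidden j \<inter> {e. snd e \<noteq> j 0}") auto
  qed
  have rm[measurable]: "Measurable.pred (Q \<Otimes>\<^sub>M PiM cells N) (\<lambda>k. reg (snd k))"
    unfolding reg_def using cm by (intro pred_intros_finite finite_hidden) (auto intro!: borel_measurable_le)
  have [measurable]: "Measurable.pred (Q \<Otimes>\<^sub>M PiM cells N) (\<lambda>k. winner j b (snd k) x)" for x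
    using wm by (intro measurable_winner j)
  have Fm: "(\<lambda>(q, w). F q w) \<in> borel_measurable (Q \<Otimes>\<^sub>M PiM cells N)"
    unfolding F_def split_beta by measurable
  have Gm: "(\<lambda>(q, w). G q w) \<in> borel_measurable (Q \<Otimes>\<^sub>M PiM cells N)"
    unfolding G_def split_beta by measurable
  have FG: "F q w \<le> G q (thresholds j b q w)" for q w
    unfolding F_def G_def
  proof (rule sum_mono)
    fix x assume x: "x \<in> S"
    show "(if explained \<epsilon> j b q w x then 1 else 0 :: ennreal)
      \<le> (if window \<epsilon> j q (thresholds j b q w) x \<and> winner j b (thresholds j b q w) x \<and> reg (thresholds j b q w) then 1 else 0)"
      using thresholds_in_region[OF j b x _ _ pos(3), of q w]
      by (auto simp: explained_def reg_def window_def visible_thresholds)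
  qed
  have "(\<integral>\<^sup>+w. \<integral>\<^sup>+q. F q w \<partial>Q \<partial>PiM cells D) \<le>
      (\<Prod>e\<in>cells. if e \<in> hidden j then ennreal \<phi> else 1) * (\<integral>\<^sup>+w. \<integral>\<^sup>+q. F q w \<partial>Q \<partial>PiM cells N)"
  proof (rule nn_integral_PiM_dominated[OF _ psD psN])
    show "(\<lambda>w. \<integral>\<^sup>+q. F q w \<partial>Q) \<in> borel_measurable (PiM cells N)"
      unfolding F_def Q_def by (rule measurable_nn_integral_explained[OF j(2) setsN])
    fix e and f :: "real \<Rightarrow> ennreal" assume e: "e \<in> cells" "f \<in> borel_measurable (N e)"
    then show "(\<integral>\<^sup>+x. f x \<partial>D e) \<le> (if e \<in> hidden j then ennreal \<phi> else 1) * (\<integral>\<^sup>+x. f x \<partial>N e)"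
      using dom[of e f] by (auto simp: N_def)
  qed (auto simp: setsN D)
  also have "(\<Prod>e\<in>cells. if e \<in> hidden j then ennreal \<phi> else 1) = ennreal (\<phi> ^ (d * (d + 1) div 2))"
  proof -
    have "cells \<inter> {e. e \<in> hidden j} = hidden j" using sub by auto
    then show ?thesis
      using pos card_hidden[OF j(1)] by (subst prod.If_cases) (auto simp: ennreal_power)
  qed
  also have "(\<integral>\<^sup>+w. \<integral>\<^sup>+q. F q w \<partial>Q \<partial>PiM cells N) = (\<integral>\<^sup>+q. \<integral>\<^sup>+w. F q w \<partial>PiM cells N \<partial>Q)"
    by (rule QN.Fubini'[OF Fm])
  also have "\<dots> \<le> (\<integral>\<^sup>+q. \<integral>\<^sup>+w. G q (thresholds j b q w) \<partial>PiM cells N \<partial>Q)"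
    by (intro nn_integral_mono FG)
  also have "\<dots> = (\<integral>\<^sup>+q. \<integral>\<^sup>+w. G q w \<partial>PiM cells N \<partial>Q)"
  proof (rule nn_integral_cong)
    fix q assume "q \<in> space Q"
    then have "G q \<in> borel_measurable (PiM cells N)"
      using measurable_compose[OF measurable_Pair1' Gm, of q] by simp
    then show "(\<integral>\<^sup>+w. G q (thresholds j b q w) \<partial>PiM cells N) = (\<integral>\<^sup>+w. G q w \<partial>PiM cells N)"
      by (intro nn_integral_thresholds j b psN setsN) (simp_all add: N_def)
  qed
  also have "\<dots> = (\<integral>\<^sup>+w. \<integral>\<^sup>+q. G q w \<partial>Q \<partial>PiM cells N)"
    by (rule QN.Fubini'[OF Gm, symmetric])
  also have "\<dots> \<le> (\<integral>\<^sup>+w. ennreal (\<epsilon> ^ d) * (if reg w then 1 else 0) \<partial>PiM cells N)"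
    unfolding G_def Q_def using pos by (intro nn_integral_mono nn_integral_windows_le)
  also have "\<dots> = ennreal (\<epsilon> ^ d) * (\<integral>\<^sup>+w. (if reg w then 1 else 0) \<partial>PiM cells N)"
  proof (rule nn_integral_cmult)
    \<comment> \<open>A point of \<open>Q\<close> is wanted to obtain measurability of
      \<open>reg\<close> as a section of its lift to the product.\<close>
    have "space Q \<noteq> {}" by (auto simp: Q_def space_PiM PiE_eq_empty_iff)
    then obtain q where "q \<in> space Q" by blast
    from measurable_compose[OF measurable_Pair1'[OF this] rm]
    have "Measurable.pred (PiM cells N) reg" by simp
    then show "(\<lambda>w. if reg w then 1 else 0 :: ennreal) \<in> borel_measurable (PiM cells N)" by measurable
  qed
  also have "(\<integral>\<^sup>+w. (if reg w then 1 else 0) \<partial>PiM cells N) =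
      ennreal ((2 * (real n + 1)) ^ d * (2 * real d) ^ (d * (d + 1) div 2 - d))"
    unfolding reg_def using D by (intro nn_integral_region j psN setsN) (auto simp: N_def)
  finally show ?thesis
    using pos unfolding F_def Q_def
    by (simp add: ennreal_mult[symmetric] mult_left_mono)
qed

end

section \<open>The expected number of Pareto optima\<close>

lemma card_upper_triangle: "card {(t, l). t \<le> l \<and> l < (d::nat)} = d * (d + 1) div 2"
proof -
  have "{(t, l). t \<le> l \<and> l < d} = prod.swap ` (SIGMA l:{..<d}. {..l})"
    by (force simp: image_iff)
  then have "card {(t, l). t \<le> l \<and> l < d} = card (SIGMA l:{..<d}. {..l})"
    by (simp add: card_image)
  also have "\<dots> = (\<Sum>l<d. Suc l)" by simp
  also have "\<dots> = d * (d + 1) div 2" by (induction d) auto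
  finally show ?thesis .
qed

lemma finite_upper_triangle: "finite {(t, l). t \<le> l \<and> l < (d::nat)}"
  by (rule finite_subset[of _ "{..<d} \<times> {..<d}"]) auto

lemma testimony_count_times_volume_le:
  fixes \<phi> :: real
  assumes "1 \<le> d" "1 \<le> n" "0 < \<phi>"
  defines "D \<equiv> d * (d + 1) div 2"
  shows "real (n ^ d * 2 ^ D) * (\<phi> ^ D * ((2 * (real n + 1)) ^ d * (2 * real d) ^ (D - d)))
    \<le> 2 * (4 * \<phi> * real d) ^ D * real n ^ (2 * d)"
proof -
  have dD: "d \<le> D"
  proof -
    have "d * 2 \<le> d * (d + 1)" using assms(1) by (intro mult_left_mono) auto
    then show ?thesis unfolding D_def by linarith
  qed
  \<comment> \<open>For \<open>d = 1\<close> this is an equality, which uses up the leading factor 2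
    of the final bound; otherwise \<open>4 \<le> 2 * d\<close>.\<close>
  have 4: "(4::real) ^ d \<le> 2 * (2 * real d) ^ d"
  proof (cases "d = 1")
    case False
    then have "(4::real) ^ d \<le> (2 * real d) ^ d" using assms(1) by (intro power_mono) auto
    moreover have "0 \<le> (2 * real d) ^ d" by simp
    ultimately show ?thesis by linarith
  qed simp
  have "(2 * (real n + 1)) ^ d \<le> (4 * real n) ^ d"
    using assms(2) by (intro power_mono) auto
  also have "\<dots> \<le> 2 * (2 * real d) ^ d * real n ^ d"
    using 4 by (simp add: power_mult_distrib mult_right_mono)
  finally have "(2 * (real n + 1)) ^ d * (2 * real d) ^ (D - d) \<le> 2 * (2 * real d) ^ d * real n ^ d * (2 * real d) ^ (D - d)"
    by (intro mult_right_mono) auto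
  also have "\<dots> = 2 * (2 * real d) ^ D * real n ^ d"
    using dD by (simp add: mult_ac flip: power_add)
  finally have "real (n ^ d * 2 ^ D) * (\<phi> ^ D * ((2 * (real n + 1)) ^ d * (2 * real d) ^ (D - d))) \<le>
      real (n ^ d * 2 ^ D) * (\<phi> ^ D * (2 * (2 * real d) ^ D * real n ^ d))"
    using assms(3) by (intro mult_left_mono) auto
  also have "\<dots> = 2 * (2 * \<phi> * (2 * real d)) ^ D * (real n ^ d * real n ^ d)"
  proof -
    have "(4::real) ^ D = 2 ^ D * 2 ^ D" by (simp flip: power_mult_distrib)
    then show ?thesis by (simp add: power_mult_distrib)
  qed
  also have "real n ^ d * real n ^ d = real n ^ (2 * d)"
    by (simp add: mult_2 power_add)
  finally show ?thesis by (simp add: mult_ac)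
qed

context smoothed_pareto
begin

abbreviation optima :: "(nat \<times> nat \<Rightarrow> real) \<Rightarrow> (nat \<Rightarrow> real) set" where
  "optima w \<equiv> pareto_optima (d + 1) (objective n d (curry w) g) S"

definition separated :: "real \<Rightarrow> (nat \<times> nat \<Rightarrow> real) \<Rightarrow> bool" where
  "separated \<epsilon> w \<longleftrightarrow> (\<forall>i\<in>{1..d}. \<forall>y\<in>S. \<forall>z\<in>S. y \<noteq> z \<longrightarrow> \<epsilon> \<le> \<bar>val w i y - val w i z\<bar>)"

definition testimonies :: "((nat \<Rightarrow> nat) \<times> (nat \<times> nat \<Rightarrow> real)) set" where
  "testimonies = {j \<in> {..<d} \<rightarrow>\<^sub>E {1..n}. inj_on j {..<d}} \<times> ({(t, l). t \<le> l \<and> l < d} \<rightarrow>\<^sub>E {0, 1})"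

lemma finite_testimonies: "finite testimonies"
  unfolding testimonies_def
  by (intro finite_cartesian_product finite_PiE finite_upper_triangle finite_Collect_conjI disjI1) (auto intro!: finite_PiE)

lemma card_testimonies: "card testimonies \<le> n ^ d * 2 ^ (d * (d + 1) div 2)"
proof -
  have "card {j \<in> {..<d} \<rightarrow>\<^sub>E {1..n}. inj_on j {..<d}} \<le> card ({..<d} \<rightarrow>\<^sub>E {1..n})"
    by (intro card_mono finite_PiE) auto
  also have "\<dots> = n ^ d" by (simp add: card_PiE)
  finally have "card {j \<in> {..<d} \<rightarrow>\<^sub>E {1..n}. inj_on j {..<d}} \<le> n ^ d" .
  moreover have "card ({(t, l). t \<le> l \<and> l < d} \<rightarrow>\<^sub>E {0, 1 :: real}) = 2 ^ (d * (d + 1) div 2)"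
    by (simp only: card_PiE[OF finite_upper_triangle] prod_constant card_upper_triangle) (simp add: numeral_2_eq_2)
  ultimately show ?thesis
    unfolding testimonies_def card_cartesian_product by simp
qed

text \<open>Each optimum is explained by one and the same testimony for all \<open>q\<close> in a
  box of volume \<open>\<epsilon> ^ d\<close>, so it contributes at least that much to the sum of
  the integrals.\<close>

lemma card_optima_le:
  assumes "0 < \<epsilon>" "separated \<epsilon> w" "\<forall>e\<in>cells. \<bar>w e\<bar> \<le> 1"
  shows "ennreal (\<epsilon> ^ d) * of_nat (card (optima w)) \<le>
    (\<Sum>(j, b)\<in>testimonies. \<integral>\<^sup>+q. (\<Sum>x\<in>S. if explained \<epsilon> j b q w x then 1 else 0) \<partial>PiM {1..d} (\<lambda>_. lborel))"
proof -
  define Q where "Q = PiM {1..d} (\<lambda>_. lborel :: real measure)"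
  define F where "F = (\<lambda>x (j, b). \<integral>\<^sup>+q. (if explained \<epsilon> j b q w x then 1 else 0) \<partial>Q)"
  have sub: "optima w \<subseteq> S" by (auto simp: pareto_optima_def)
  have each: "ennreal (\<epsilon> ^ d) \<le> (\<Sum>\<tau>\<in>testimonies. F x \<tau>)" if x: "x \<in> optima w" for x
  proof -
    have gap: "\<epsilon> \<le> \<bar>val w i y - val w i z\<bar>" if "i \<in> {1..d}" "y \<in> S" "z \<in> S" "y \<noteq> z" for i y z
      using assms(2) that unfolding separated_def by blast
    obtain j b where j: "inj_on j {..<d}" "j \<in> {..<d} \<rightarrow>\<^sub>E {1..n}"
      and b: "b \<in> {(t, l). t \<le> l \<and> l < d} \<rightarrow>\<^sub>E {0, 1}"
      and win: "\<And>q. (\<And>i. i \<in> {1..d} \<Longrightarrow> visible j w i x \<le> q i \<and> q i < visible j w i x + \<epsilon>) \<Longrightarrow> winner j b (thresholds j b q w) x"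
      using pareto_optimum_is_winner[OF x gap assms(1)] by blast
    have "explained \<epsilon> j b q w x \<longleftrightarrow> (\<forall>i\<in>{1..d}. visible j w i x \<le> q i \<and> q i < visible j w i x + \<epsilon>)" for q
      using win[of q] assms(3) by (auto simp: explained_def window_def)
    then have "F x (j, b) = ennreal (\<epsilon> ^ d)"
      using nn_integral_window_box[of "{1..d}" \<epsilon> "\<lambda>i. visible j w i x"] assms(1) by (simp add: F_def Q_def)
    moreover have "(j, b) \<in> testimonies" using j b by (simp add: testimonies_def)
    ultimately show ?thesis
      using member_le_sum[of "(j, b)" testimonies "F x"] finite_testimonies by simp
  qed
  have meas: "(\<lambda>q. if explained \<epsilon> j b q w x then 1 else 0 :: ennreal) \<in> borel_measurable Q"
    if j: "j \<in> {..<d} \<rightarrow>\<^sub>E {1..n}" for j b x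
  proof -
    have "j ` {..<d} \<subseteq> {1..n}" using j by auto
    note jm = this
    have qm: "(\<lambda>q. q i) \<in> borel_measurable Q" if "i \<in> {1..d}" for i
      using measurable_component_singleton[OF that, of "\<lambda>_. lborel :: real measure"] by (simp add: Q_def)
    have tm: "(\<lambda>q. thresholds j b q w e) \<in> borel_measurable Q" if "e \<in> cells" for e
      unfolding thresholds_def using qm[of "fst e"] that by (cases "e \<in> hidden j") auto
    have "Measurable.pred Q (\<lambda>q. winner j b (thresholds j b q w) x)"
      by (intro measurable_winner tm jm)
    moreover have "Measurable.pred Q (\<lambda>q. window \<epsilon> j q w x)"
      unfolding window_def using qm
      by (intro pred_intros_finite pred_intros_logic borel_measurable_pred_less) (auto intro!: borel_measurable_le)
    ultimately have "Measurable.pred Q (\<lambda>q. explained \<epsilon> j b q w x)"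
      unfolding explained_def by (intro pred_intros_logic) auto
    then show ?thesis by measurable
  qed
  have "ennreal (\<epsilon> ^ d) * of_nat (card (optima w)) = (\<Sum>x\<in>optima w. ennreal (\<epsilon> ^ d))"
    by (simp add: mult.commute)
  also have "\<dots> \<le> (\<Sum>x\<in>optima w. \<Sum>\<tau>\<in>testimonies. F x \<tau>)" by (intro sum_mono each)
  also have "\<dots> \<le> (\<Sum>x\<in>S. \<Sum>\<tau>\<in>testimonies. F x \<tau>)"
    using sub finite_S by (intro sum_mono2) auto
  also have "\<dots> = (\<Sum>\<tau>\<in>testimonies. \<Sum>x\<in>S. F x \<tau>)" by (rule sum.swap)
  also have "\<dots> = (\<Sum>(j, b)\<in>testimonies. \<integral>\<^sup>+q. (\<Sum>x\<in>S. if explained \<epsilon> j b q w x then 1 else 0) \<partial>Q)"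
  proof (rule sum.cong)
    fix \<tau> assume "\<tau> \<in> testimonies"
    then obtain j b where "\<tau> = (j, b)" "j \<in> {..<d} \<rightarrow>\<^sub>E {1..n}" by (auto simp: testimonies_def)
    then show "(\<Sum>x\<in>S. F x \<tau>) = (case \<tau> of (j, b) \<Rightarrow> \<integral>\<^sup>+q. (\<Sum>x\<in>S. if explained \<epsilon> j b q w x then 1 else 0) \<partial>Q)"
      using meas by (simp add: F_def nn_integral_sum)
  qed simp
  finally show ?thesis unfolding Q_def .
qed

section \<open>Measurability and almost sure separation\<close>

lemma measurable_val:
  fixes N :: "nat \<times> nat \<Rightarrow> real measure"
  assumes N: "\<And>e. sets (N e) = sets borel" and "i \<in> {1..d + 1}"
  shows "(\<lambda>w. val w i y) \<in> borel_measurable (PiM cells N)"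
proof -
  have comp: "(\<lambda>w. w e) \<in> borel_measurable (PiM cells N)" if "e \<in> cells" for e
    using measurable_component_singleton[OF that, of N] N by (simp cong: measurable_cong_sets)
  show ?thesis
    unfolding objective_def using comp assms(2)
    by (cases "i = d + 1") (auto intro!: borel_measurable_sum borel_measurable_times)
qed

lemma measurable_card_optima:
  fixes N :: "nat \<times> nat \<Rightarrow> real measure"
  assumes N: "\<And>e. sets (N e) = sets borel"
  shows "(\<lambda>w. card (optima w)) \<in> PiM cells N \<rightarrow>\<^sub>M count_space UNIV"
proof -
  have vm: "(\<lambda>w. val w i y) \<in> borel_measurable (PiM cells N)" if "i \<in> {1..d+1}" for i y
    by (rule measurable_val[OF N that])
  have p: "Measurable.pred (PiM cells N) (\<lambda>w. x \<in> optima w)" for x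
    unfolding pareto_optima_def mem_Collect_eq using vm finite_S
    by (intro pred_intros_finite pred_intros_logic borel_measurable_pred_less) auto
  have "card (optima w) = (\<Sum>x\<in>S. if x \<in> optima w then 1 else 0)" for w
  proof -
    have "S \<inter> optima w = optima w" by (auto simp: pareto_optima_def)
    then show ?thesis using finite_S by (simp add: sum.If_cases)
  qed
  moreover have "(\<lambda>w. \<Sum>x\<in>S. if x \<in> optima w then 1 else 0 :: nat) \<in> PiM cells N \<rightarrow>\<^sub>M count_space UNIV"
    using p by measurable
  ultimately show ?thesis by simp
qed

lemma measurable_separated:
  fixes N :: "nat \<times> nat \<Rightarrow> real measure"
  assumes N: "\<And>e. sets (N e) = sets borel"
  shows "Measurable.pred (PiM cells N) (separated \<epsilon>)"
proof -
  have vm: "(\<lambda>w. val w i y) \<in> borel_measurable (PiM cells N)" if "i \<in> {1..d}" for i y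
    using that by (intro measurable_val[OF N]) auto
  show ?thesis
    unfolding separated_def[abs_def] using vm finite_S
    by (intro pred_intros_finite pred_intros_logic) (auto intro!: borel_measurable_le)
qed

text \<open>In a column \<open>m\<close> where \<open>y\<close> and \<open>z\<close> differ, equal
  values force \<open>w (i, m)\<close> to be one number \<open>c\<close> determined by the rest of
  the row. By \<open>dom\<close>, single points have mass zero.\<close>

lemma AE_val_neq:
  fixes D :: "nat \<times> nat \<Rightarrow> real measure"
  assumes D: "\<And>e. prob_space (D e)" "\<And>e. sets (D e) = sets borel"
    and dom: "\<And>e f. e \<in> cells \<Longrightarrow> f \<in> borel_measurable borel \<Longrightarrow>
        (\<integral>\<^sup>+x. f x \<partial>D e) \<le> ennreal \<phi> * (\<integral>\<^sup>+x. f x \<partial>lborel)"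
    and i: "i \<in> {1..d}" and yz: "y \<in> S" "z \<in> S" "y \<noteq> z"
  shows "AE w in PiM cells D. val w i y \<noteq> val w i z"
proof -
  interpret D: product_sigma_finite D
    by (simp add: product_sigma_finite_def prob_space_imp_sigma_finite D)
  obtain m where m: "m \<in> {1..n}" "z m = 1 - y m"
    using binary_vectors_diff yz S by (metis subsetD)
  have "y m = 0 \<or> y m = 1" using m yz S by (intro binary_vectors_cases) auto
  then have ym: "y m - z m \<noteq> 0" using m by auto
  define J where "J = cells - {(i, m)}"
  have J: "insert (i, m) J = cells" "finite J" "(i, m) \<notin> J" using i m by (auto simp: J_def)
  have [measurable]: "(\<lambda>w. val w i y) \<in> borel_measurable (PiM cells D)" for y
    using i by (intro measurable_val D) auto
  have Em: "(\<lambda>w. if val w i y = val w i z then 1 else 0 :: ennreal) \<in> borel_measurable (PiM cells D)"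
    by measurable
  have "(\<integral>\<^sup>+w. (if val w i y = val w i z then 1 else 0 :: ennreal) \<partial>PiM cells D) =
    (\<integral>\<^sup>+w. \<integral>\<^sup>+u. (if val (w((i, m) := u)) i y = val (w((i, m) := u)) i z then 1 else 0) \<partial>D (i, m) \<partial>PiM J D)"
    using D.product_nn_integral_insert[OF J(2,3), of "\<lambda>w. if val w i y = val w i z then 1 else 0"] Em
    by (simp add: J(1))
  also have "\<dots> = (\<integral>\<^sup>+w. 0 \<partial>PiM J D)"
  proof (rule nn_integral_cong)
    fix w :: "nat \<times> nat \<Rightarrow> real"
    define c where "c = (\<Sum>k\<in>{1..n} - {m}. w (i, k) * (z k - y k)) / (y m - z m)"
    have val_upd: "val (w((i, m) := u)) i v = u * v m + (\<Sum>k\<in>{1..n} - {m}. w (i, k) * v k)" for u v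
    proof -
      have "val (w((i, m) := u)) i v = (\<Sum>k\<in>{1..n}. (w((i, m) := u)) (i, k) * v k)"
        using i by (simp add: objective_def)
      also have "\<dots> = u * v m + (\<Sum>k\<in>{1..n} - {m}. (w((i, m) := u)) (i, k) * v k)"
        using m(1) by (subst sum.remove[of _ m]) auto
      also have "(\<Sum>k\<in>{1..n} - {m}. (w((i, m) := u)) (i, k) * v k) = (\<Sum>k\<in>{1..n} - {m}. w (i, k) * v k)"
        by (intro sum.cong) auto
      finally show ?thesis .
    qed
    have "u = c" if "val (w((i, m) := u)) i y = val (w((i, m) := u)) i z" for u
    proof -
      have "u * (y m - z m) = (\<Sum>k\<in>{1..n} - {m}. w (i, k) * (z k - y k))"
        using that unfolding val_upd by (simp add: right_diff_distrib sum_subtractf)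
      then show ?thesis using ym by (simp add: c_def field_simps)
    qed
    then have "(\<integral>\<^sup>+u. (if val (w((i, m) := u)) i y = val (w((i, m) := u)) i z then 1 else 0) \<partial>D (i, m))
      \<le> (\<integral>\<^sup>+u. indicator {c} u \<partial>D (i, m))"
      by (intro nn_integral_mono) auto
    also have "\<dots> \<le> ennreal \<phi> * (\<integral>\<^sup>+u. indicator {c} u \<partial>lborel)"
      using i m by (intro dom) auto
    also have "\<dots> = 0" by simp
    finally show "(\<integral>\<^sup>+u. (if val (w((i, m) := u)) i y = val (w((i, m) := u)) i z then 1 else 0 :: ennreal) \<partial>D (i, m)) = 0"
      by simp
  qed
  also have "\<dots> = 0" by simp
  finally have "AE w in PiM cells D. (if val w i y = val w i z then 1 else 0 :: ennreal) = 0"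
    using nn_integral_0_iff_AE[OF Em] by blast
  then show ?thesis by eventually_elim (auto split: if_splits)
qed

lemma separated_eventually:
  assumes "\<forall>i\<in>{1..d}. \<forall>y\<in>S. \<forall>z\<in>S. y \<noteq> z \<longrightarrow> val w i y \<noteq> val w i z"
  shows "\<exists>k. separated (1 / real (Suc k)) w"
proof -
  define A where "A = (\<lambda>(i, y, z). \<bar>val w i y - val w i z\<bar>) ` {(i, y, z). i \<in> {1..d} \<and> y \<in> S \<and> z \<in> S \<and> y \<noteq> z}"
  have "{(i, y, z). i \<in> {1..d} \<and> y \<in> S \<and> z \<in> S \<and> y \<noteq> z} \<subseteq> {1..d} \<times> S \<times> S" by auto
  then have "finite A" unfolding A_def using finite_S by (meson finite_imageI finite_subset finite_SigmaI finite_atLeastAtMost)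
  \<comment> \<open>Inserting 1 keeps the minimum defined when \<open>S\<close> has no two distinct
    elements.\<close>
  then have fin: "finite (insert 1 A)" by simp
  have "\<forall>a\<in>insert 1 A. 0 < a" using assms by (auto simp: A_def)
  then have "0 < Min (insert 1 A)" using fin by (subst Min_gr_iff) auto
  then obtain k where k: "1 / real (Suc k) < Min (insert 1 A)"
    using reals_Archimedean by (auto simp: inverse_eq_divide)
  have "separated (1 / real (Suc k)) w"
    unfolding separated_def
  proof (intro ballI impI)
    fix i y z assume "i \<in> {1..d}" "y \<in> S" "z \<in> S" "y \<noteq> z"
    then have "\<bar>val w i y - val w i z\<bar> \<in> insert 1 A" unfolding A_def by force
    then have "Min (insert 1 A) \<le> \<bar>val w i y - val w i z\<bar>" using fin Min_le by blast
    then show "1 / real (Suc k) \<le> \<bar>val w i y - val w i z\<bar>" using k by linarith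
  qed
  then show ?thesis ..
qed

text \<open>On matrices separated by \<open>1 / (k + 1)\<close> the factor
  \<open>\<epsilon> ^ d\<close> cancels and the bound is independent of \<open>k\<close>. Almost
  every matrix is separated for some \<open>k\<close>, and smaller gaps are weaker conditions, so
  monotone convergence applies.\<close>

lemma expected_card_optima:
  fixes D :: "nat \<times> nat \<Rightarrow> real measure"
  assumes D: "\<And>e. prob_space (D e)" "\<And>e. sets (D e) = sets borel"
    and dom: "\<And>e f. e \<in> cells \<Longrightarrow> f \<in> borel_measurable borel \<Longrightarrow>
        (\<integral>\<^sup>+x. f x \<partial>D e) \<le> ennreal \<phi> * (\<integral>\<^sup>+x. f x \<partial>lborel)"
    and supp: "\<And>e. e \<in> cells \<Longrightarrow> AE x in D e. \<bar>x\<bar> \<le> 1"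
    and \<phi>: "0 < \<phi>"
  shows "(\<integral>\<^sup>+w. of_nat (card (optima w)) \<partial>PiM cells D)
    \<le> ennreal (2 * (4 * \<phi> * real d) ^ (d * (d + 1) div 2) * real n ^ (2 * d))" (is "_ \<le> ?B")
proof -
  define bnd where "bnd = (\<lambda>w::nat\<times>nat\<Rightarrow>real. \<forall>e\<in>cells. \<bar>w e\<bar> \<le> 1)"
  define V where "V = \<phi> ^ (d * (d + 1) div 2) * ((2 * (real n + 1)) ^ d * (2 * real d) ^ (d * (d + 1) div 2 - d))"
  have V: "0 \<le> V" unfolding V_def using \<phi> by auto
  have comp: "(\<lambda>w. w e) \<in> borel_measurable (PiM cells D)" if "e \<in> cells" for e
    using measurable_component_singleton[OF that, of D] D(2) by (simp cong: measurable_cong_sets)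
  have [measurable]: "Measurable.pred (PiM cells D) bnd"
    unfolding bnd_def using comp by (intro pred_intros_finite) (auto intro!: borel_measurable_le)
  have [measurable]: "Measurable.pred (PiM cells D) (separated \<epsilon>)" for \<epsilon>
    by (rule measurable_separated[OF D(2)])
  have [measurable]: "(\<lambda>w. of_nat (card (optima w)) :: ennreal) \<in> borel_measurable (PiM cells D)"
    using measurable_compose[OF measurable_card_optima[of D, OF D(2)], of of_nat "borel :: ennreal measure"] by simp
  define f where "f = (\<lambda>k w. if separated (1 / real (Suc k)) w \<and> bnd w then of_nat (card (optima w)) else 0 :: ennreal)"
  have fm: "f k \<in> borel_measurable (PiM cells D)" for k unfolding f_def by measurable
  have fle: "(\<integral>\<^sup>+w. f k w \<partial>PiM cells D) \<le> ?B" for k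
  proof -
    define \<epsilon> where "\<epsilon> = 1 / real (Suc k)"
    have \<epsilon>: "0 < \<epsilon>" "\<epsilon> \<le> 1" by (auto simp: \<epsilon>_def)
    have jb: "inj_on j {..<d}" "j ` {..<d} \<subseteq> {1..n}" "b \<in> {(t, l). t \<le> l \<and> l < d} \<rightarrow> {0, 1}"
      if "(j, b) \<in> testimonies" for j b
      using that by (auto simp: testimonies_def PiE_def)
    have "ennreal (\<epsilon> ^ d) * (\<integral>\<^sup>+w. f k w \<partial>PiM cells D) = (\<integral>\<^sup>+w. ennreal (\<epsilon> ^ d) * f k w \<partial>PiM cells D)"
      by (rule nn_integral_cmult[symmetric]) (rule fm)
    also have "\<dots> \<le> (\<integral>\<^sup>+w. (\<Sum>(j, b)\<in>testimonies. \<integral>\<^sup>+q. (\<Sum>x\<in>S. if explained \<epsilon> j b q w x then 1 else 0) \<partial>PiM {1..d} (\<lambda>_. lborel)) \<partial>PiM cells D)"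
    proof (rule nn_integral_mono)
      fix w
      show "ennreal (\<epsilon> ^ d) * f k w \<le> (\<Sum>(j, b)\<in>testimonies. \<integral>\<^sup>+q. (\<Sum>x\<in>S. if explained \<epsilon> j b q w x then 1 else 0) \<partial>PiM {1..d} (\<lambda>_. lborel))"
      proof (cases "separated \<epsilon> w \<and> bnd w")
        case True
        then show ?thesis
          using card_optima_le[OF \<epsilon>(1), of w] unfolding f_def bnd_def \<epsilon>_def[symmetric] by simp
      next
        case False
        have "f k w = 0" unfolding f_def \<epsilon>_def[symmetric] by (simp only: False if_False)
        then show ?thesis by simp
      qed
    qed
    also have "\<dots> = (\<Sum>(j, b)\<in>testimonies. \<integral>\<^sup>+w. \<integral>\<^sup>+q. (\<Sum>x\<in>S. if explained \<epsilon> j b q w x then 1 else 0) \<partial>PiM {1..d} (\<lambda>_. lborel) \<partial>PiM cells D)"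
      unfolding split_beta
      using jb by (intro nn_integral_sum measurable_nn_integral_explained D) (metis prod.collapse)
    also have "\<dots> \<le> (\<Sum>(j, b)\<in>testimonies. ennreal (\<phi> ^ (d * (d + 1) div 2) * (\<epsilon> ^ d * ((2 * (real n + 1)) ^ d * (2 * real d) ^ (d * (d + 1) div 2 - d)))))"
      unfolding split_beta
    proof (rule sum_mono)
      fix \<tau> assume "\<tau> \<in> testimonies"
      then have t: "(fst \<tau>, snd \<tau>) \<in> testimonies" by simp
      show "(\<integral>\<^sup>+w. \<integral>\<^sup>+q. (\<Sum>x\<in>S. if explained \<epsilon> (fst \<tau>) (snd \<tau>) q w x then 1 else 0) \<partial>PiM {1..d} (\<lambda>_. lborel) \<partial>PiM cells D)
        \<le> ennreal (\<phi> ^ (d * (d + 1) div 2) * (\<epsilon> ^ d * ((2 * (real n + 1)) ^ d * (2 * real d) ^ (d * (d + 1) div 2 - d))))"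
        by (rule testimony_bound[OF jb[OF t] D dom \<phi> \<epsilon>])
    qed
    also have "\<dots> = ennreal (real (card testimonies) * (\<epsilon> ^ d * V))"
      using \<phi> \<epsilon> by (simp add: V_def ennreal_mult' mult_ac flip: ennreal_of_nat_eq_real_of_nat)
    also have "\<dots> \<le> ennreal (\<epsilon> ^ d) * ennreal (real (n ^ d * 2 ^ (d * (d + 1) div 2)) * V)"
    proof -
      have "real (card testimonies) \<le> real (n ^ d * 2 ^ (d * (d + 1) div 2))"
        using card_testimonies by (simp only: of_nat_le_iff)
      then have "real (card testimonies) * (\<epsilon> ^ d * V) \<le> real (n ^ d * 2 ^ (d * (d + 1) div 2)) * (\<epsilon> ^ d * V)"
        using V \<epsilon> by (intro mult_right_mono) auto
      then show ?thesis using V \<epsilon> by (subst ennreal_mult[symmetric]) (auto intro!: ennreal_leI simp: mult_ac)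
    qed
    finally have "ennreal (\<epsilon> ^ d) * (\<integral>\<^sup>+w. f k w \<partial>PiM cells D) \<le> ennreal (\<epsilon> ^ d) * ennreal (real (n ^ d * 2 ^ (d * (d + 1) div 2)) * V)" .
    then have "(\<integral>\<^sup>+w. f k w \<partial>PiM cells D) \<le> ennreal (real (n ^ d * 2 ^ (d * (d + 1) div 2)) * V)"
      using \<epsilon> by (subst (asm) ennreal_mult_le_mult_iff) auto
    also have "\<dots> \<le> ?B"
      unfolding V_def using dn \<phi> by (intro ennreal_leI testimony_count_times_volume_le) auto
    finally show ?thesis .
  qed
  have "AE w in PiM cells D. \<forall>e\<in>cells. \<bar>w e\<bar> \<le> 1"
  proof (rule AE_finite_allI)
    fix e assume e: "e \<in> cells"
    show "AE w in PiM cells D. \<bar>w e\<bar> \<le> 1"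
      by (rule AE_PiM_component[of cells D e "\<lambda>x. \<bar>x\<bar> \<le> 1", OF D(1) e supp[OF e]])
  qed simp
  moreover have "AE w in PiM cells D. \<forall>i\<in>{1..d}. \<forall>y\<in>S. \<forall>z\<in>S. y \<noteq> z \<longrightarrow> val w i y \<noteq> val w i z"
  proof (intro AE_finite_allI finite_S)
    fix i y z assume "i \<in> {1..d}" "y \<in> S" "z \<in> S"
    note iyz = this
    show "AE w in PiM cells D. y \<noteq> z \<longrightarrow> val w i y \<noteq> val w i z"
    proof (cases "y = z")
      case False
      have "AE w in PiM cells D. val w i y \<noteq> val w i z"
        by (rule AE_val_neq[where \<phi> = \<phi>, OF D(1) D(2) dom iyz False])
      then show ?thesis by (rule eventually_mono) simp
    qed simp
  qed simp
  ultimately have "AE w in PiM cells D. of_nat (card (optima w)) \<le> (SUP k. f k w)"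
  proof eventually_elim
    case (elim w)
    obtain k where "separated (1 / real (Suc k)) w" using separated_eventually[OF elim(2)] by blast
    then have "f k w = of_nat (card (optima w))" using elim(1) by (simp add: f_def bnd_def)
    then show ?case using SUP_upper[of k UNIV "\<lambda>k. f k w"] by simp
  qed
  then have "(\<integral>\<^sup>+w. of_nat (card (optima w)) \<partial>PiM cells D) \<le> (\<integral>\<^sup>+w. (SUP k. f k w) \<partial>PiM cells D)"
    by (rule nn_integral_mono_AE)
  also have "\<dots> = (SUP k. \<integral>\<^sup>+w. f k w \<partial>PiM cells D)"
  proof (rule nn_integral_monotone_convergence_SUP)
    show "incseq f"
    proof (rule incseq_SucI, rule le_funI)
      fix k w
      have "1 / real (Suc (Suc k)) \<le> 1 / real (Suc k)" by (simp add: frac_le)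
      then have "separated (1 / real (Suc k)) w \<Longrightarrow> separated (1 / real (Suc (Suc k))) w"
        unfolding separated_def by (meson order_trans)
      then show "f k w \<le> f (Suc k) w" by (auto simp: f_def)
    qed
  qed (rule fm)
  also have "\<dots> \<le> ?B" using fle by (rule SUP_least)
  finally show ?thesis .
qed

end

section \<open>From product measures to the given random variables\<close>

lemma card_binary_vectors: "card (binary_vectors n) = 2 ^ n"
  unfolding binary_vectors_def by (simp add: card_PiE numeral_2_eq_2)

lemma has_density_bounded_byD:
  assumes "has_density_bounded_by M X \<phi>" and f: "f \<in> borel_measurable borel"
  shows "(\<integral>\<^sup>+x. f x \<partial>distr M borel X) \<le> ennreal \<phi> * (\<integral>\<^sup>+x. f x \<partial>lborel)"
proof -
  from assms(1) obtain p where p: "distributed M lborel X p" "\<And>t. p t \<le> ennreal \<phi>"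
    unfolding has_density_bounded_by_def by blast
  have pm: "p \<in> borel_measurable lborel" and eq: "distr M lborel X = density lborel p"
    using p(1) by (simp_all add: distributed_def)
  have "distr M borel X = density lborel p" unfolding eq[symmetric] by (rule distr_cong) auto
  then have "(\<integral>\<^sup>+x. f x \<partial>distr M borel X) = (\<integral>\<^sup>+x. p x * f x \<partial>lborel)"
    using pm f by (simp add: nn_integral_density)
  also have "\<dots> \<le> (\<integral>\<^sup>+x. ennreal \<phi> * f x \<partial>lborel)"
    by (intro nn_integral_mono mult_right_mono p(2)) simp
  also have "\<dots> = ennreal \<phi> * (\<integral>\<^sup>+x. f x \<partial>lborel)" using f by (simp add: nn_integral_cmult)
  finally show ?thesis .
qed

text \<open>A density bounded by \<phi> gives an interval of length 2 mass at most
  \<open>2 * \<phi>\<close>. This serves the case \<open>n < d\<close>, where it makes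
  \<open>4 * \<phi> * d\<close> at least 2.\<close>

lemma density_bound_ge_half:
  assumes "prob_space M" "has_density_bounded_by M X \<phi>" "AE \<omega> in M. X \<omega> \<in> {-1..1}" "X \<in> borel_measurable M" "0 < \<phi>"
  shows "1 \<le> 2 * \<phi>"
proof -
  interpret prob_space M by fact
  have "1 = (\<integral>\<^sup>+\<omega>. indicator {-1..1} (X \<omega>) \<partial>M)"
  proof -
    have "(\<integral>\<^sup>+\<omega>. indicator {-1..1} (X \<omega>) \<partial>M) = (\<integral>\<^sup>+\<omega>. 1 \<partial>M)"
      using assms(3) by (intro nn_integral_cong_AE) (auto simp: indicator_def)
    then show ?thesis by (simp add: emeasure_space_1)
  qed
  also have "\<dots> = (\<integral>\<^sup>+x. indicator {-1..1} x \<partial>distr M borel X)"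
    by (rule nn_integral_distr[symmetric, OF assms(4)]) simp
  also have "\<dots> \<le> ennreal \<phi> * (\<integral>\<^sup>+x. indicator {-1..1::real} x \<partial>lborel)"
    by (rule has_density_bounded_byD[OF assms(2)]) simp
  also have "\<dots> = ennreal (\<phi> * 2)"
    using assms(5) by (simp add: ennreal_mult)
  finally show ?thesis using assms(5) by (simp add: mult.commute)
qed

theorem mainTheorem1:
  fixes n d :: nat and \<phi> :: real
    and S :: "(nat \<Rightarrow> real) set"
    and c_last :: "(nat \<Rightarrow> real) \<Rightarrow> real"
    and M :: "'a measure"
    and W :: "nat \<Rightarrow> nat \<Rightarrow> 'a \<Rightarrow> real"
  assumes "n \<ge> 1" and "d \<ge> 1" and "\<phi> > 0"
    and "S \<subseteq> binary_vectors n"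
    and "inj_on c_last S"
    and "prob_space M"
    and "prob_space.indep_vars M (\<lambda>_. borel) (\<lambda>(i, j). W i j) ({1..d} \<times> {1..n})"
    and "\<And>i j. i \<in> {1..d} \<Longrightarrow> j \<in> {1..n} \<Longrightarrow> has_density_bounded_by M (W i j) \<phi>"
    and "\<And>i j. i \<in> {1..d} \<Longrightarrow> j \<in> {1..n} \<Longrightarrow> AE \<omega> in M. W i j \<omega> \<in> {-1..1}"
  shows "(\<integral>\<omega>. real (card (pareto_optima (d + 1)
              (objective n d (\<lambda>i j. W i j \<omega>) c_last) S)) \<partial>M)
         \<le> 2 * (4 * \<phi> * real d) ^ (d * (d + 1) div 2) * real n ^ (2 * d)"
proof -
  interpret prob_space M by fact
  let ?PO = "\<lambda>\<omega>. pareto_optima (d + 1) (objective n d (\<lambda>i j. W i j \<omega>) c_last) S"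
  let ?B = "2 * (4 * \<phi> * real d) ^ (d * (d + 1) div 2) * real n ^ (2 * d)"
  let ?cells = "{1..d} \<times> {1..n}"
  have rv: "W i j \<in> borel_measurable M" if "i \<in> {1..d}" "j \<in> {1..n}" for i j
    using assms(7) that by (auto simp: indep_vars_def)
  show ?thesis
  proof (cases "d \<le> n")
    case False
    \<comment> \<open>For \<open>n < d\<close> there are at most \<open>2 ^ n \<le> 2 ^ d\<close>
      solutions, and the claimed bound is larger: its base is at least 2 and its exponent at least
      \<open>d\<close>.\<close>
    have half: "1 \<le> 2 * \<phi>"
      using assms(1,2,3) by (intro density_bound_ge_half[OF assms(6) assms(8) assms(9) rv, of 1 1]) auto
    have "card (?PO \<omega>) \<le> 2 ^ d" for \<omega>
    proof -
      have "card (?PO \<omega>) \<le> card (binary_vectors n)"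
        using assms(4) finite_binary_vectors by (intro card_mono) (auto simp: pareto_optima_def)
      also have "\<dots> \<le> 2 ^ d" using False by (simp add: card_binary_vectors)
      finally show ?thesis .
    qed
    then have le: "real (card (?PO \<omega>)) \<le> 2 ^ d" for \<omega>
      by (metis of_nat_le_iff of_nat_numeral of_nat_power)
    have "(2::real) ^ d \<le> 2 ^ (d * (d + 1) div 2)"
    proof (rule power_increasing)
      have "d * 2 \<le> d * (d + 1)" using assms(2) by (intro mult_left_mono) auto
      then show "d \<le> d * (d + 1) div 2" by linarith
    qed simp
    also have "\<dots> \<le> (4 * \<phi> * real d) ^ (d * (d + 1) div 2)"
    proof (rule power_mono)
      have "2 * 1 \<le> (4 * \<phi>) * real d" using half assms(2) by (intro mult_mono) auto
      then show "2 \<le> 4 * \<phi> * real d" by simp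
    qed simp
    also have "\<dots> \<le> 2 * (4 * \<phi> * real d) ^ (d * (d + 1) div 2)" using assms(3) by simp
    also have "\<dots> \<le> ?B"
    proof -
      have "1 \<le> real n ^ (2 * d)" using assms(1) by simp
      from mult_left_mono[OF this, of "2 * (4 * \<phi> * real d) ^ (d * (d + 1) div 2)"]
      show ?thesis using assms(3) by simp
    qed
    finally have B: "2 ^ d \<le> ?B" .
    show ?thesis
    proof (cases "integrable M (\<lambda>\<omega>. real (card (?PO \<omega>)))")
      case True
      then have "(\<integral>\<omega>. real (card (?PO \<omega>)) \<partial>M) \<le> 2 ^ d" using le by (intro integral_le_const) auto
      then show ?thesis using B by linarith
    next
      \<comment> \<open>The integral of a non-integrable function is 0 by convention.\<close>
      case False
      then show ?thesis using assms(3) by (simp add: not_integrable_integral_eq)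
    qed
  next
    case True
    interpret smoothed_pareto n d S c_last using True assms by unfold_locales auto
    define X where "X = (\<lambda>e. W (fst e) (snd e))"
    \<comment> \<open>The default outside the cells makes \<open>D e\<close> a probability measure
      on the Borel sets for every \<open>e\<close>, as the product lemmas demand.\<close>
    define D where "D = (\<lambda>e. if e \<in> ?cells then distr M borel (X e) else return borel 0)"
    define R where "R = (\<lambda>\<omega>. \<lambda>e\<in>?cells. X e \<omega>)"
    have Xm: "X e \<in> borel_measurable M" if "e \<in> ?cells" for e using rv that by (auto simp: X_def)
    have Dp: "prob_space (D e)" for e
      using Xm by (auto simp: D_def intro!: prob_space_distr prob_space_return)
    have Ds: "sets (D e) = sets borel" for e by (simp add: D_def)
    have dom: "(\<integral>\<^sup>+x. f x \<partial>D e) \<le> ennreal \<phi> * (\<integral>\<^sup>+x. f x \<partial>lborel)"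
      if "e \<in> ?cells" "f \<in> borel_measurable borel" for e f
      using has_density_bounded_byD[OF assms(8), of "fst e" "snd e" f] that by (auto simp: D_def X_def)
    have supp: "AE x in D e. \<bar>x\<bar> \<le> 1" if "e \<in> ?cells" for e
    proof -
      have "AE \<omega> in M. \<bar>X e \<omega>\<bar> \<le> 1"
        using assms(9)[of "fst e" "snd e"] that by (auto simp: X_def abs_le_iff elim!: eventually_mono)
      then have "AE x in distr M borel (X e). \<bar>x\<bar> \<le> 1"
        by (subst AE_distr_iff[OF Xm[OF that]]) auto
      then show ?thesis using that by (simp only: D_def if_True)
    qed
    have Rm: "R \<in> M \<rightarrow>\<^sub>M PiM ?cells (\<lambda>_. borel)"
      unfolding R_def using Xm by (intro measurable_restrict) auto
    have "distr M (PiM ?cells (\<lambda>_. borel)) R = PiM ?cells (\<lambda>e. distr M borel (X e))"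
      unfolding R_def using assms(1,2,7) Xm
      by (subst indep_vars_iff_distr_eq_PiM'[symmetric]) (auto simp: X_def case_prod_unfold)
    also have "\<dots> = PiM ?cells D" by (intro PiM_cong) (auto simp: D_def)
    finally have distr: "distr M (PiM ?cells (\<lambda>_. borel)) R = PiM ?cells D" .
    have PO: "?PO \<omega> = optima (R \<omega>)" for \<omega>
    proof -
      have "objective n d (\<lambda>i j. W i j \<omega>) c_last y i = val (R \<omega>) i y" if "i \<in> {1..d+1}" for y i
        using that by (auto simp: objective_def R_def X_def intro!: sum.cong)
      then show ?thesis by (simp add: pareto_optima_def)
    qed
    have cm: "(\<lambda>w. card (optima w)) \<in> PiM ?cells (\<lambda>_. borel) \<rightarrow>\<^sub>M count_space UNIV"
      by (rule measurable_card_optima) simp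
    have m: "(\<lambda>\<omega>. real (card (?PO \<omega>))) \<in> borel_measurable M"
      unfolding PO using measurable_compose[OF measurable_compose[OF Rm cm], of real borel] by simp
    have cm': "(\<lambda>w. of_nat (card (optima w)) :: ennreal) \<in> borel_measurable (PiM ?cells (\<lambda>_. borel))"
      using measurable_compose[OF cm, of of_nat "borel :: ennreal measure"] by simp
    have "(\<integral>\<^sup>+\<omega>. ennreal (real (card (?PO \<omega>))) \<partial>M) = (\<integral>\<^sup>+\<omega>. of_nat (card (optima (R \<omega>))) \<partial>M)"
      unfolding PO by (simp add: ennreal_of_nat_eq_real_of_nat)
    also have "\<dots> = (\<integral>\<^sup>+w. of_nat (card (optima w)) \<partial>PiM ?cells D)"
      unfolding distr[symmetric] by (rule nn_integral_distr[symmetric, OF Rm]) (use cm' in simp)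
    also have "\<dots> \<le> ennreal ?B"
      by (rule expected_card_optima[OF Dp Ds dom supp assms(3)])
    finally have "(\<integral>\<^sup>+\<omega>. ennreal (real (card (?PO \<omega>))) \<partial>M) \<le> ennreal ?B" .
    then show ?thesis
      using assms(3) m by (subst integral_eq_nn_integral) (auto intro!: enn2real_leI)
  qed
qed

end
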